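(* Let $\mathbb A$ be a double category with tabulators, and let $I\in \mathbb A$ be an object. Then the following statements are equivalent. (i) The object $I$ is double bi-initial in $\mathbb A$. (ii) The object $I$ is bi-initial in the $2$-category $\mathbf H\mathbb A$.
   Context: **Double categories** are strict. They have objects, horizontal morphisms, vertical morphisms and squares; a square has a top and a bottom horizontal morphism and a left and a right vertical morphism. $\mathrm e_A$ denotes the vertical identity at $A$ and $\mathrm e_a$ the vertical identity square at a horizontal morphism $a$. A square whose left and right boundaries are vertical identities is vertically invertible if it has an inverse for vertical composition. **$\mathbf H\mathbb A$** is the $2$-category with the objects of $\mathbb A$, morphisms the horizontal morphisms of $\mathbb A$, and $2$-morphisms $a\Rightarrow b$ (for $a,b\colon A\to A'$) the squares with top $a$, bottom $b$, left $\mathrm e_A$, right $\mathrm e_{A'}$. **Tabulators.** A tabulator of a vertical morphism $u$ from $A$ to $B$ is a pair $(\top u,\tau_u)$ of an object $\top u$ and a square $\tau_u$ with top $p\colon\top u\to A$, bottom $q\colon \top u\to B$, left $\mathrm e_{\top u}$, right $u$, such that: (1) for every square $\gamma$ with top $f\colon I\to A$, bottom $g\colon I\to B$, left $\mathrm e_I$, right $u$, there is a unique horizontal morphism $t\colon I\to\top u$ such that $\gamma$ equals the horizontal composite of $\mathrm e_t$ followed by $\tau_u$; (2) for all squares $\gamma$ (top $f$, bottom $g$, left $\mathrm e_I$, right $u$), $\gamma'$ (top $f'$, bottom $g'$, left $\mathrm e_{I'}$, right $u$), $\theta_0$ (top $f'$, bottom $f$, left $v$, right $\mathrm e_A$) and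 $\theta_1$ (top $g'$, bottom $g$, left $v$, right $\mathrm e_B$), with $v$ a vertical morphism from $I'$ to $I$, such that $\theta_0$ pasted vertically above $\gamma$ equals $\gamma'$ pasted vertically above $\theta_1$, there is a unique square $\theta$ with top $t'$, bottom $t$, left $v$, right $\mathrm e_{\top u}$, where $t,t'$ are the horizontal morphisms obtained from $\gamma,\gamma'$ by (1), such that $\theta_0$ is the horizontal composite of $\theta$ followed by $\mathrm e_p$ and $\theta_1$ is the horizontal composite of $\theta$ followed by $\mathrm e_q$. $\mathbb A$ has tabulators if every vertical morphism of $\mathbb A$ has a tabulator. **Bi-initial object.** For an object $I$ of a $2$-category $\mathbf A$, the pseudo-slice $2$-category $I\downarrow\mathbf A$ has objects $(A,f\colon I\to A)$; morphisms $(A,f)\to(A',f')$ pairs $(a,\psi)$ of $a\colon A\to A'$ and an invertible $\psi\colon f'\Rightarrow af$; $2$-morphisms $(a,\psi)\Rightarrow(b,\varphi)$ the $2$-morphisms $\beta\colon a\Rightarrow b$ with $(\beta f)\circ\psi=\varphi$. A $2$-functor is a trivial fibration if it is surjective on objects, full on morphisms (every morphism $FA\to FA'$ is the image of some morphism $A\to A'$) and fully faithful on $2$-morphisms. $I$ is bi-initial if the projection $I\downarrow\mathbf A\to\mathbf A$ is a trivial fibration. **Double bi-initial object.** For an object $I$ of $\mathbb A$, the pseudo-slice double category $I\downarrow\downarrow\mathbb A$ has: objects $(A,f)$ with $f\colon I\to A$ horizontal; horizontal morphisms $(A,f)\to(A',f')$: pairs $(a,\psi)$ of a horizontal $a\colon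 A\to A'$ and a vertically invertible square $\psi$ with top $f'$, bottom $af$, left $\mathrm e_I$, right $\mathrm e_{A'}$; vertical morphisms from $(A,f)$ to $(B,g)$: pairs $(u,\gamma)$ of a vertical morphism $u$ from $A$ to $B$ and a square $\gamma$ with top $f$, bottom $g$, left $\mathrm e_I$, right $u$; squares with top $(a,\psi)$, bottom $(b,\varphi)$, left $(u,\gamma)$, right $(u',\gamma')$: squares $\alpha$ of $\mathbb A$ with top $a$, bottom $b$, left $u$, right $u'$ such that $\psi$ pasted vertically above the horizontal composite of $\gamma$ and $\alpha$ equals $\gamma'$ pasted vertically above $\varphi$. Let $\Pi\colon I\downarrow\downarrow\mathbb A\to\mathbb A$ be the projection. A double functor is a double trivial fibration if it is surjective on objects, full on horizontal morphisms (every horizontal morphism $FA\to FA'$ is the image of some $A\to A'$), surjective on vertical morphisms, and fully faithful on squares (every square whose boundary is the image of a given boundary is the image of a unique square with that given boundary). The object $I$ is double bi-initial if $\Pi$ is a double trivial fibration. *)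

theory Defs
  imports Main
begin

text \<open>
  Categorical structures are given by carrier sets and total operations that are only meaningful
  on the carriers. All compositions are written in diagrammatic order: the first argument
  comes first, that is, to the left for horizontal and above for vertical composition.
\<close>

locale category_on =
  fixes Ob :: "'o set" and Ar :: "'a set"
    and dom :: "'a \<Rightarrow> 'o" and cod :: "'a \<Rightarrow> 'o"
    and ide :: "'o \<Rightarrow> 'a" and cmp :: "'a \<Rightarrow> 'a \<Rightarrow> 'a"
  assumes dom_in: "f \<in> Ar \<Longrightarrow> dom f \<in> Ob"
    and cod_in: "f \<in> Ar \<Longrightarrow> cod f \<in> Ob"
    and ide_in: "A \<in> Ob \<Longrightarrow> ide A \<in> Ar"
    and dom_ide: "A \<in> Ob \<Longrightarrow> dom (ide A) = A"
    and cod_ide: "A \<in> Ob \<Longrightarrow> cod (ide A) = A"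
    and cmp_in: "\<lbrakk>f \<in> Ar; g \<in> Ar; cod f = dom g\<rbrakk> \<Longrightarrow> cmp f g \<in> Ar"
    and dom_cmp: "\<lbrakk>f \<in> Ar; g \<in> Ar; cod f = dom g\<rbrakk> \<Longrightarrow> dom (cmp f g) = dom f"
    and cod_cmp: "\<lbrakk>f \<in> Ar; g \<in> Ar; cod f = dom g\<rbrakk> \<Longrightarrow> cod (cmp f g) = cod g"
    and ide_cmp: "f \<in> Ar \<Longrightarrow> cmp (ide (dom f)) f = f"
    and cmp_ide: "f \<in> Ar \<Longrightarrow> cmp f (ide (cod f)) = f"
    and cmp_assoc: "\<lbrakk>f \<in> Ar; g \<in> Ar; h \<in> Ar; cod f = dom g; cod g = dom h\<rbrakk>
      \<Longrightarrow> cmp (cmp f g) h = cmp f (cmp g h)"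


section \<open>Strict 2-categories\<close>

record ('o, 'm, 'c) twocat =
  Ob :: "'o set"
  Mor :: "'m set"
  Cell :: "'c set"
  src :: "'m \<Rightarrow> 'o"
  tgt :: "'m \<Rightarrow> 'o"
  id1 :: "'o \<Rightarrow> 'm"
  comp1 :: "'m \<Rightarrow> 'm \<Rightarrow> 'm"
  src2 :: "'c \<Rightarrow> 'm"
  tgt2 :: "'c \<Rightarrow> 'm"
  id2 :: "'m \<Rightarrow> 'c"
  vcomp2 :: "'c \<Rightarrow> 'c \<Rightarrow> 'c"
  hcomp2 :: "'c \<Rightarrow> 'c \<Rightarrow> 'c"

locale two_category =
  one: category_on "Ob C" "Mor C" "src C" "tgt C" "id1 C" "comp1 C" +
  vert: category_on "Mor C" "Cell C" "src2 C" "tgt2 C" "id2 C" "vcomp2 C" +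
  horiz: category_on "Ob C" "Cell C" "\<lambda>c. src C (src2 C c)" "\<lambda>c. tgt C (src2 C c)"
    "\<lambda>A. id2 C (id1 C A)" "hcomp2 C"
  for C :: "('o, 'm, 'c) twocat" +
  assumes src_tgt2: "c \<in> Cell C \<Longrightarrow> src C (tgt2 C c) = src C (src2 C c)"
    and tgt_tgt2: "c \<in> Cell C \<Longrightarrow> tgt C (tgt2 C c) = tgt C (src2 C c)"
    and src2_hcomp2: "\<lbrakk>c \<in> Cell C; d \<in> Cell C; tgt C (src2 C c) = src C (src2 C d)\<rbrakk>
      \<Longrightarrow> src2 C (hcomp2 C c d) = comp1 C (src2 C c) (src2 C d)"
    and tgt2_hcomp2: "\<lbrakk>c \<in> Cell C; d \<in> Cell C; tgt C (src2 C c) = src C (src2 C d)\<rbrakk>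
      \<Longrightarrow> tgt2 C (hcomp2 C c d) = comp1 C (tgt2 C c) (tgt2 C d)"
    and id2_comp1: "\<lbrakk>f \<in> Mor C; g \<in> Mor C; tgt C f = src C g\<rbrakk>
      \<Longrightarrow> id2 C (comp1 C f g) = hcomp2 C (id2 C f) (id2 C g)"
    and interchange2: "\<lbrakk>c \<in> Cell C; d \<in> Cell C; c' \<in> Cell C; d' \<in> Cell C;
        tgt C (src2 C c) = src C (src2 C d); tgt C (src2 C c') = src C (src2 C d');
        tgt2 C c = src2 C c'; tgt2 C d = src2 C d'\<rbrakk>
      \<Longrightarrow> vcomp2 C (hcomp2 C c d) (hcomp2 C c' d') = hcomp2 C (vcomp2 C c c') (vcomp2 C d d')"

definition homs :: "('o, 'm, 'c) twocat \<Rightarrow> 'o \<Rightarrow> 'o \<Rightarrow> 'm set" where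
  "homs C A B = {f \<in> Mor C. src C f = A \<and> tgt C f = B}"

definition cells :: "('o, 'm, 'c) twocat \<Rightarrow> 'm \<Rightarrow> 'm \<Rightarrow> 'c set" where
  "cells C f g = {c \<in> Cell C. src2 C c = f \<and> tgt2 C c = g}"

definition invertible2 :: "('o, 'm, 'c) twocat \<Rightarrow> 'c \<Rightarrow> bool" where
  "invertible2 C c \<longleftrightarrow> c \<in> Cell C \<and> (\<exists>d \<in> cells C (tgt2 C c) (src2 C c).
     vcomp2 C c d = id2 C (src2 C c) \<and> vcomp2 C d c = id2 C (tgt2 C c))"

record ('o, 'm, 'c, 'p, 'n, 'd) twomap =
  onOb :: "'o \<Rightarrow> 'p"
  onMor :: "'m \<Rightarrow> 'n"
  onCell :: "'c \<Rightarrow> 'd"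

locale two_functor =
  X: two_category X + Y: two_category Y
  for X :: "('o, 'm, 'c) twocat" and Y :: "('p, 'n, 'd) twocat"
    and F :: "('o, 'm, 'c, 'p, 'n, 'd) twomap" +
  assumes onOb_in: "A \<in> Ob X \<Longrightarrow> onOb F A \<in> Ob Y"
    and onMor_in: "\<lbrakk>A \<in> Ob X; B \<in> Ob X; f \<in> homs X A B\<rbrakk>
      \<Longrightarrow> onMor F f \<in> homs Y (onOb F A) (onOb F B)"
    and onCell_in: "\<lbrakk>f \<in> Mor X; g \<in> Mor X; c \<in> cells X f g\<rbrakk>
      \<Longrightarrow> onCell F c \<in> cells Y (onMor F f) (onMor F g)"
    and onMor_id1: "A \<in> Ob X \<Longrightarrow> onMor F (id1 X A) = id1 Y (onOb F A)"
    and onMor_comp1: "\<lbrakk>f \<in> Mor X; g \<in> Mor X; tgt X f = src X g\<rbrakk>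
      \<Longrightarrow> onMor F (comp1 X f g) = comp1 Y (onMor F f) (onMor F g)"
    and onCell_id2: "f \<in> Mor X \<Longrightarrow> onCell F (id2 X f) = id2 Y (onMor F f)"
    and onCell_vcomp2: "\<lbrakk>c \<in> Cell X; d \<in> Cell X; tgt2 X c = src2 X d\<rbrakk>
      \<Longrightarrow> onCell F (vcomp2 X c d) = vcomp2 Y (onCell F c) (onCell F d)"
    and onCell_hcomp2: "\<lbrakk>c \<in> Cell X; d \<in> Cell X; tgt X (src2 X c) = src X (src2 X d)\<rbrakk>
      \<Longrightarrow> onCell F (hcomp2 X c d) = hcomp2 Y (onCell F c) (onCell F d)"

definition trivial_fibration ::
  "('o, 'm, 'c) twocat \<Rightarrow> ('p, 'n, 'd) twocat \<Rightarrow> ('o, 'm, 'c, 'p, 'n, 'd) twomap \<Rightarrow> bool" where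
  "trivial_fibration X Y F \<longleftrightarrow>
     two_functor X Y F \<and>
     (\<forall>B \<in> Ob Y. \<exists>A \<in> Ob X. onOb F A = B) \<and>
     (\<forall>A \<in> Ob X. \<forall>A' \<in> Ob X. \<forall>b \<in> homs Y (onOb F A) (onOb F A').
        \<exists>a \<in> homs X A A'. onMor F a = b) \<and>
     (\<forall>A \<in> Ob X. \<forall>A' \<in> Ob X. \<forall>a \<in> homs X A A'. \<forall>b \<in> homs X A A'.
        \<forall>d \<in> cells Y (onMor F a) (onMor F b). \<exists>!c. c \<in> cells X a b \<and> onCell F c = d)"

subsection \<open>Pseudo-slices and bi-initial objects\<close>

text \<open>
  A morphism \<open>(a, \<psi>)\<close> of the pseudo-slice does not determine its source \<open>(A, f)\<close>, and a 2-morphism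
  \<open>\<beta>\<close> of the underlying 2-category does not determine the morphisms \<open>(a, \<psi>)\<close> and \<open>(b, \<phi>)\<close> it goes
  between; the tuples below therefore record the source and the target.
\<close>

definition slice_ob :: "('o, 'm, 'c) twocat \<Rightarrow> 'o \<Rightarrow> ('o \<times> 'm) set" where
  "slice_ob C I = {(A, f). A \<in> Ob C \<and> f \<in> homs C I A}"

type_synonym ('o, 'm, 'c) slice_mor = "('o \<times> 'm) \<times> ('o \<times> 'm) \<times> 'm \<times> 'c"

definition slice_mor :: "('o, 'm, 'c) twocat \<Rightarrow> 'o \<Rightarrow> ('o, 'm, 'c) slice_mor set" where
  "slice_mor C I = {((A, f), (A', f'), a, \<psi>).
     (A, f) \<in> slice_ob C I \<and> (A', f') \<in> slice_ob C I \<and> a \<in> homs C A A' \<and>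
     \<psi> \<in> cells C f' (comp1 C f a) \<and> invertible2 C \<psi>}"

definition slice_cell :: "('o, 'm, 'c) twocat \<Rightarrow> 'o \<Rightarrow>
    (('o, 'm, 'c) slice_mor \<times> ('o, 'm, 'c) slice_mor \<times> 'c) set" where
  "slice_cell C I = {((x, y, a, \<psi>), (x', y', b, \<phi>), \<beta>).
     (x, y, a, \<psi>) \<in> slice_mor C I \<and> (x', y', b, \<phi>) \<in> slice_mor C I \<and> x' = x \<and> y' = y \<and>
     \<beta> \<in> cells C a b \<and> vcomp2 C \<psi> (hcomp2 C (id2 C (snd x)) \<beta>) = \<phi>}"

definition slice_comp1 :: "('o, 'm, 'c) twocat \<Rightarrow>
    ('o, 'm, 'c) slice_mor \<Rightarrow> ('o, 'm, 'c) slice_mor \<Rightarrow> ('o, 'm, 'c) slice_mor" where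
  "slice_comp1 C = (\<lambda>(x, y, a, \<psi>) (y', z, b, \<phi>).
     (x, z, comp1 C a b, vcomp2 C \<phi> (hcomp2 C \<psi> (id2 C b))))"

definition pseudo_slice :: "('o, 'm, 'c) twocat \<Rightarrow> 'o \<Rightarrow> ('o \<times> 'm, ('o, 'm, 'c) slice_mor,
    ('o, 'm, 'c) slice_mor \<times> ('o, 'm, 'c) slice_mor \<times> 'c) twocat" where
  "pseudo_slice C I = \<lparr>
     Ob = slice_ob C I,
     Mor = slice_mor C I,
     Cell = slice_cell C I,
     src = (\<lambda>(x, y, a, \<psi>). x),
     tgt = (\<lambda>(x, y, a, \<psi>). y),
     id1 = (\<lambda>(A, f). ((A, f), (A, f), id1 C A, id2 C f)),
     comp1 = slice_comp1 C,
     src2 = (\<lambda>(m, n, \<beta>). m),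
     tgt2 = (\<lambda>(m, n, \<beta>). n),
     id2 = (\<lambda>m. (m, m, id2 C (fst (snd (snd m))))),
     vcomp2 = (\<lambda>(m, n, \<beta>) (m', n', \<beta>'). (m, n', vcomp2 C \<beta> \<beta>')),
     hcomp2 = (\<lambda>(m, n, \<beta>) (m', n', \<beta>').
       (slice_comp1 C m m', slice_comp1 C n n', hcomp2 C \<beta> \<beta>'))\<rparr>"

definition slice_proj :: "('o \<times> 'm, ('o, 'm, 'c) slice_mor,
    ('o, 'm, 'c) slice_mor \<times> ('o, 'm, 'c) slice_mor \<times> 'c, 'o, 'm, 'c) twomap" where
  "slice_proj = \<lparr>
     onOb = (\<lambda>(A, f). A),
     onMor = (\<lambda>(x, y, a, \<psi>). a),
     onCell = (\<lambda>(m, n, \<beta>). \<beta>)\<rparr>"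

definition bi_initial :: "('o, 'm, 'c) twocat \<Rightarrow> 'o \<Rightarrow> bool" where
  "bi_initial C I \<longleftrightarrow> I \<in> Ob C \<and> trivial_fibration (pseudo_slice C I) C slice_proj"


section \<open>Strict double categories\<close>

record ('o, 'h, 'v, 's) dblcat =
  Obj :: "'o set"
  Hor :: "'h set"
  Ver :: "'v set"
  Sqr :: "'s set"
  hdom :: "'h \<Rightarrow> 'o"
  hcod :: "'h \<Rightarrow> 'o"
  hid :: "'o \<Rightarrow> 'h"
  hcomp :: "'h \<Rightarrow> 'h \<Rightarrow> 'h"
  vdom :: "'v \<Rightarrow> 'o"
  vcod :: "'v \<Rightarrow> 'o"
  vid :: "'o \<Rightarrow> 'v"
  vcomp :: "'v \<Rightarrow> 'v \<Rightarrow> 'v"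
  sqtop :: "'s \<Rightarrow> 'h"
  sqbot :: "'s \<Rightarrow> 'h"
  sqleft :: "'s \<Rightarrow> 'v"
  sqright :: "'s \<Rightarrow> 'v"
  hidsq :: "'v \<Rightarrow> 's"  \<comment> \<open>identities for \<open>hcompsq\<close>\<close>
  hcompsq :: "'s \<Rightarrow> 's \<Rightarrow> 's"
  vidsq :: "'h \<Rightarrow> 's"  \<comment> \<open>identities for \<open>vcompsq\<close>\<close>
  vcompsq :: "'s \<Rightarrow> 's \<Rightarrow> 's"

locale double_category =
  hor: category_on "Obj D" "Hor D" "hdom D" "hcod D" "hid D" "hcomp D" +
  ver: category_on "Obj D" "Ver D" "vdom D" "vcod D" "vid D" "vcomp D" +
  hsq: category_on "Ver D" "Sqr D" "sqleft D" "sqright D" "hidsq D" "hcompsq D" +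
  vsq: category_on "Hor D" "Sqr D" "sqtop D" "sqbot D" "vidsq D" "vcompsq D"
  for D :: "('o, 'h, 'v, 's) dblcat" +
  assumes hdom_sqtop: "s \<in> Sqr D \<Longrightarrow> hdom D (sqtop D s) = vdom D (sqleft D s)"
    and hcod_sqtop: "s \<in> Sqr D \<Longrightarrow> hcod D (sqtop D s) = vdom D (sqright D s)"
    and hdom_sqbot: "s \<in> Sqr D \<Longrightarrow> hdom D (sqbot D s) = vcod D (sqleft D s)"
    and hcod_sqbot: "s \<in> Sqr D \<Longrightarrow> hcod D (sqbot D s) = vcod D (sqright D s)"
    and sqtop_hidsq: "u \<in> Ver D \<Longrightarrow> sqtop D (hidsq D u) = hid D (vdom D u)"
    and sqbot_hidsq: "u \<in> Ver D \<Longrightarrow> sqbot D (hidsq D u) = hid D (vcod D u)"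
    and sqleft_vidsq: "a \<in> Hor D \<Longrightarrow> sqleft D (vidsq D a) = vid D (hdom D a)"
    and sqright_vidsq: "a \<in> Hor D \<Longrightarrow> sqright D (vidsq D a) = vid D (hcod D a)"
    and sqtop_hcompsq: "\<lbrakk>s \<in> Sqr D; t \<in> Sqr D; sqright D s = sqleft D t\<rbrakk>
      \<Longrightarrow> sqtop D (hcompsq D s t) = hcomp D (sqtop D s) (sqtop D t)"
    and sqbot_hcompsq: "\<lbrakk>s \<in> Sqr D; t \<in> Sqr D; sqright D s = sqleft D t\<rbrakk>
      \<Longrightarrow> sqbot D (hcompsq D s t) = hcomp D (sqbot D s) (sqbot D t)"
    and sqleft_vcompsq: "\<lbrakk>s \<in> Sqr D; t \<in> Sqr D; sqbot D s = sqtop D t\<rbrakk>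
      \<Longrightarrow> sqleft D (vcompsq D s t) = vcomp D (sqleft D s) (sqleft D t)"
    and sqright_vcompsq: "\<lbrakk>s \<in> Sqr D; t \<in> Sqr D; sqbot D s = sqtop D t\<rbrakk>
      \<Longrightarrow> sqright D (vcompsq D s t) = vcomp D (sqright D s) (sqright D t)"
    and hidsq_vid: "A \<in> Obj D \<Longrightarrow> hidsq D (vid D A) = vidsq D (hid D A)"
    and hidsq_vcomp: "\<lbrakk>u \<in> Ver D; v \<in> Ver D; vcod D u = vdom D v\<rbrakk>
      \<Longrightarrow> hidsq D (vcomp D u v) = vcompsq D (hidsq D u) (hidsq D v)"
    and vidsq_hcomp: "\<lbrakk>a \<in> Hor D; b \<in> Hor D; hcod D a = hdom D b\<rbrakk>
      \<Longrightarrow> vidsq D (hcomp D a b) = hcompsq D (vidsq D a) (vidsq D b)"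
    and interchange: "\<lbrakk>s \<in> Sqr D; t \<in> Sqr D; s' \<in> Sqr D; t' \<in> Sqr D;
        sqright D s = sqleft D t; sqright D s' = sqleft D t';
        sqbot D s = sqtop D s'; sqbot D t = sqtop D t'\<rbrakk>
      \<Longrightarrow> vcompsq D (hcompsq D s t) (hcompsq D s' t') = hcompsq D (vcompsq D s s') (vcompsq D t t')"

definition hhoms :: "('o, 'h, 'v, 's) dblcat \<Rightarrow> 'o \<Rightarrow> 'o \<Rightarrow> 'h set" where
  "hhoms D A B = {a \<in> Hor D. hdom D a = A \<and> hcod D a = B}"

definition vhoms :: "('o, 'h, 'v, 's) dblcat \<Rightarrow> 'o \<Rightarrow> 'o \<Rightarrow> 'v set" where
  "vhoms D A B = {u \<in> Ver D. vdom D u = A \<and> vcod D u = B}"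

text \<open>\<open>squares D a b u v\<close>: squares with top \<open>a\<close>, bottom \<open>b\<close>, left \<open>u\<close> and right \<open>v\<close>.\<close>

definition squares :: "('o, 'h, 'v, 's) dblcat \<Rightarrow> 'h \<Rightarrow> 'h \<Rightarrow> 'v \<Rightarrow> 'v \<Rightarrow> 's set" where
  "squares D a b u v =
     {s \<in> Sqr D. sqtop D s = a \<and> sqbot D s = b \<and> sqleft D s = u \<and> sqright D s = v}"

definition vert_invertible :: "('o, 'h, 'v, 's) dblcat \<Rightarrow> 's \<Rightarrow> bool" where
  "vert_invertible D s \<longleftrightarrow> s \<in> Sqr D \<and>
     sqleft D s = vid D (hdom D (sqtop D s)) \<and> sqright D s = vid D (hcod D (sqtop D s)) \<and>
     (\<exists>t \<in> Sqr D. sqtop D t = sqbot D s \<and> sqbot D t = sqtop D s \<and>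
        vcompsq D s t = vidsq D (sqtop D s) \<and> vcompsq D t s = vidsq D (sqbot D s))"

definition hor_twocat :: "('o, 'h, 'v, 's) dblcat \<Rightarrow> ('o, 'h, 's) twocat" where
  "hor_twocat D = \<lparr>
     Ob = Obj D,
     Mor = Hor D,
     Cell = {s \<in> Sqr D. sqleft D s = vid D (hdom D (sqtop D s)) \<and>
                        sqright D s = vid D (hcod D (sqtop D s))},
     src = hdom D,
     tgt = hcod D,
     id1 = hid D,
     comp1 = hcomp D,
     src2 = sqtop D,
     tgt2 = sqbot D,
     id2 = vidsq D,
     vcomp2 = vcompsq D,
     hcomp2 = hcompsq D\<rparr>"

subsection \<open>Tabulators\<close>

definition is_tabulator :: "('o, 'h, 'v, 's) dblcat \<Rightarrow> 'v \<Rightarrow> 'o \<Rightarrow> 's \<Rightarrow> bool" where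
  "is_tabulator D u T \<tau> \<longleftrightarrow>
     (let A = vdom D u; B = vcod D u; p = sqtop D \<tau>; q = sqbot D \<tau> in
      T \<in> Obj D \<and> p \<in> hhoms D T A \<and> q \<in> hhoms D T B \<and> \<tau> \<in> squares D p q (vid D T) u \<and>
      (\<forall>I \<in> Obj D. \<forall>f \<in> hhoms D I A. \<forall>g \<in> hhoms D I B. \<forall>\<gamma> \<in> squares D f g (vid D I) u.
         \<exists>!t. t \<in> hhoms D I T \<and> \<gamma> = hcompsq D (vidsq D t) \<tau>) \<and>
      (\<forall>I \<in> Obj D. \<forall>I' \<in> Obj D. \<forall>v \<in> vhoms D I' I.
       \<forall>f \<in> hhoms D I A. \<forall>g \<in> hhoms D I B. \<forall>f' \<in> hhoms D I' A. \<forall>g' \<in> hhoms D I' B.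
       \<forall>\<gamma> \<in> squares D f g (vid D I) u. \<forall>\<gamma>' \<in> squares D f' g' (vid D I') u.
       \<forall>\<theta>\<^sub>0 \<in> squares D f' f v (vid D A). \<forall>\<theta>\<^sub>1 \<in> squares D g' g v (vid D B).
         vcompsq D \<theta>\<^sub>0 \<gamma> = vcompsq D \<gamma>' \<theta>\<^sub>1 \<longrightarrow>
         (\<forall>t \<in> hhoms D I T. \<forall>t' \<in> hhoms D I' T.
            \<gamma> = hcompsq D (vidsq D t) \<tau> \<and> \<gamma>' = hcompsq D (vidsq D t') \<tau> \<longrightarrow>
            (\<exists>!\<theta>. \<theta> \<in> squares D t' t v (vid D T) \<and>
               \<theta>\<^sub>0 = hcompsq D \<theta> (vidsq D p) \<and> \<theta>\<^sub>1 = hcompsq D \<theta> (vidsq D q)))))"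

definition has_tabulators :: "('o, 'h, 'v, 's) dblcat \<Rightarrow> bool" where
  "has_tabulators D \<longleftrightarrow> (\<forall>u \<in> Ver D. \<exists>T \<tau>. is_tabulator D u T \<tau>)"

subsection \<open>Double functors and double trivial fibrations\<close>

record ('o, 'h, 'v, 's, 'p, 'i, 'w, 't) dblmap =
  onObj :: "'o \<Rightarrow> 'p"
  onHor :: "'h \<Rightarrow> 'i"
  onVer :: "'v \<Rightarrow> 'w"
  onSqr :: "'s \<Rightarrow> 't"

locale double_functor =
  X: double_category X + Y: double_category Y
  for X :: "('o, 'h, 'v, 's) dblcat" and Y :: "('p, 'i, 'w, 't) dblcat"
    and F :: "('o, 'h, 'v, 's, 'p, 'i, 'w, 't) dblmap" +
  assumes onObj_in: "A \<in> Obj X \<Longrightarrow> onObj F A \<in> Obj Y"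
    and onHor_in: "\<lbrakk>A \<in> Obj X; B \<in> Obj X; a \<in> hhoms X A B\<rbrakk>
      \<Longrightarrow> onHor F a \<in> hhoms Y (onObj F A) (onObj F B)"
    and onVer_in: "\<lbrakk>A \<in> Obj X; B \<in> Obj X; u \<in> vhoms X A B\<rbrakk>
      \<Longrightarrow> onVer F u \<in> vhoms Y (onObj F A) (onObj F B)"
    and onSqr_in: "\<lbrakk>a \<in> Hor X; b \<in> Hor X; u \<in> Ver X; v \<in> Ver X; s \<in> squares X a b u v\<rbrakk>
      \<Longrightarrow> onSqr F s \<in> squares Y (onHor F a) (onHor F b) (onVer F u) (onVer F v)"
    and onHor_hid: "A \<in> Obj X \<Longrightarrow> onHor F (hid X A) = hid Y (onObj F A)"
    and onHor_hcomp: "\<lbrakk>a \<in> Hor X; b \<in> Hor X; hcod X a = hdom X b\<rbrakk>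
      \<Longrightarrow> onHor F (hcomp X a b) = hcomp Y (onHor F a) (onHor F b)"
    and onVer_vid: "A \<in> Obj X \<Longrightarrow> onVer F (vid X A) = vid Y (onObj F A)"
    and onVer_vcomp: "\<lbrakk>u \<in> Ver X; v \<in> Ver X; vcod X u = vdom X v\<rbrakk>
      \<Longrightarrow> onVer F (vcomp X u v) = vcomp Y (onVer F u) (onVer F v)"
    and onSqr_hidsq: "u \<in> Ver X \<Longrightarrow> onSqr F (hidsq X u) = hidsq Y (onVer F u)"
    and onSqr_hcompsq: "\<lbrakk>s \<in> Sqr X; t \<in> Sqr X; sqright X s = sqleft X t\<rbrakk>
      \<Longrightarrow> onSqr F (hcompsq X s t) = hcompsq Y (onSqr F s) (onSqr F t)"
    and onSqr_vidsq: "a \<in> Hor X \<Longrightarrow> onSqr F (vidsq X a) = vidsq Y (onHor F a)"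
    and onSqr_vcompsq: "\<lbrakk>s \<in> Sqr X; t \<in> Sqr X; sqbot X s = sqtop X t\<rbrakk>
      \<Longrightarrow> onSqr F (vcompsq X s t) = vcompsq Y (onSqr F s) (onSqr F t)"

definition double_trivial_fibration :: "('o, 'h, 'v, 's) dblcat \<Rightarrow> ('p, 'i, 'w, 't) dblcat \<Rightarrow>
    ('o, 'h, 'v, 's, 'p, 'i, 'w, 't) dblmap \<Rightarrow> bool" where
  "double_trivial_fibration X Y F \<longleftrightarrow>
     double_functor X Y F \<and>
     (\<forall>B \<in> Obj Y. \<exists>A \<in> Obj X. onObj F A = B) \<and>
     (\<forall>A \<in> Obj X. \<forall>A' \<in> Obj X. \<forall>b \<in> hhoms Y (onObj F A) (onObj F A').
        \<exists>a \<in> hhoms X A A'. onHor F a = b) \<and>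
     (\<forall>w \<in> Ver Y. \<exists>u \<in> Ver X. onVer F u = w) \<and>
     (\<forall>A \<in> Obj X. \<forall>A' \<in> Obj X. \<forall>B \<in> Obj X. \<forall>B' \<in> Obj X.
      \<forall>a \<in> hhoms X A A'. \<forall>b \<in> hhoms X B B'. \<forall>u \<in> vhoms X A B. \<forall>u' \<in> vhoms X A' B'.
      \<forall>\<alpha> \<in> squares Y (onHor F a) (onHor F b) (onVer F u) (onVer F u').
        \<exists>!s. s \<in> squares X a b u u' \<and> onSqr F s = \<alpha>)"

subsection \<open>Pseudo-slice double categories and double bi-initial objects\<close>

text \<open>
  As above, horizontal morphisms and squares record their boundaries. A vertical morphism
  \<open>(u, \<gamma>)\<close> goes from \<open>(A, f)\<close> to \<open>(B, g)\<close> with \<open>f\<close> and \<open>g\<close> the top and bottom of \<open>\<gamma>\<close>.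
\<close>

definition dslice_obj :: "('o, 'h, 'v, 's) dblcat \<Rightarrow> 'o \<Rightarrow> ('o \<times> 'h) set" where
  "dslice_obj D I = {(A, f). A \<in> Obj D \<and> f \<in> hhoms D I A}"

type_synonym ('o, 'h, 's) dslice_hor = "('o \<times> 'h) \<times> ('o \<times> 'h) \<times> 'h \<times> 's"

definition dslice_hor :: "('o, 'h, 'v, 's) dblcat \<Rightarrow> 'o \<Rightarrow> ('o, 'h, 's) dslice_hor set" where
  "dslice_hor D I = {((A, f), (A', f'), a, \<psi>).
     (A, f) \<in> dslice_obj D I \<and> (A', f') \<in> dslice_obj D I \<and> a \<in> hhoms D A A' \<and>
     \<psi> \<in> squares D f' (hcomp D f a) (vid D I) (vid D A') \<and> vert_invertible D \<psi>}"

definition dslice_ver :: "('o, 'h, 'v, 's) dblcat \<Rightarrow> 'o \<Rightarrow> ('v \<times> 's) set" where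
  "dslice_ver D I = {(u, \<gamma>). \<exists>A f B g.
     (A, f) \<in> dslice_obj D I \<and> (B, g) \<in> dslice_obj D I \<and> u \<in> vhoms D A B \<and>
     \<gamma> \<in> squares D f g (vid D I) u}"

type_synonym ('o, 'h, 'v, 's) dslice_sqr =
  "('o, 'h, 's) dslice_hor \<times> ('o, 'h, 's) dslice_hor \<times> ('v \<times> 's) \<times> ('v \<times> 's) \<times> 's"

definition dslice_sqr :: "('o, 'h, 'v, 's) dblcat \<Rightarrow> 'o \<Rightarrow> ('o, 'h, 'v, 's) dslice_sqr set" where
  "dslice_sqr D I =
     {(((A, f), (A', f'), a, \<psi>), ((B, g), (B', g'), b, \<phi>), (u, \<gamma>), (u', \<gamma>'), \<alpha>).
       ((A, f), (A', f'), a, \<psi>) \<in> dslice_hor D I \<and> ((B, g), (B', g'), b, \<phi>) \<in> dslice_hor D I \<and>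
       u \<in> vhoms D A B \<and> \<gamma> \<in> squares D f g (vid D I) u \<and>
       u' \<in> vhoms D A' B' \<and> \<gamma>' \<in> squares D f' g' (vid D I) u' \<and>
       \<alpha> \<in> squares D a b u u' \<and>
       vcompsq D \<psi> (hcompsq D \<gamma> \<alpha>) = vcompsq D \<gamma>' \<phi>}"

definition dslice_hcomp :: "('o, 'h, 'v, 's) dblcat \<Rightarrow>
    ('o, 'h, 's) dslice_hor \<Rightarrow> ('o, 'h, 's) dslice_hor \<Rightarrow> ('o, 'h, 's) dslice_hor" where
  "dslice_hcomp D = (\<lambda>(x, y, a, \<psi>) (y', z, b, \<phi>).
     (x, z, hcomp D a b, vcompsq D \<phi> (hcompsq D \<psi> (vidsq D b))))"

definition dslice_hid :: "('o, 'h, 'v, 's) dblcat \<Rightarrow> ('o \<times> 'h) \<Rightarrow> ('o, 'h, 's) dslice_hor" where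
  "dslice_hid D = (\<lambda>(A, f). ((A, f), (A, f), hid D A, vidsq D f))"

definition dslice_vcomp :: "('o, 'h, 'v, 's) dblcat \<Rightarrow> 'v \<times> 's \<Rightarrow> 'v \<times> 's \<Rightarrow> 'v \<times> 's" where
  "dslice_vcomp D = (\<lambda>(u, \<gamma>) (v, \<delta>). (vcomp D u v, vcompsq D \<gamma> \<delta>))"

definition dslice_vid :: "('o, 'h, 'v, 's) dblcat \<Rightarrow> 'o \<times> 'h \<Rightarrow> 'v \<times> 's" where
  "dslice_vid D = (\<lambda>(A, f). (vid D A, vidsq D f))"

definition double_pseudo_slice :: "('o, 'h, 'v, 's) dblcat \<Rightarrow> 'o \<Rightarrow>
    ('o \<times> 'h, ('o, 'h, 's) dslice_hor, 'v \<times> 's, ('o, 'h, 'v, 's) dslice_sqr) dblcat" where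
  "double_pseudo_slice D I = \<lparr>
     Obj = dslice_obj D I,
     Hor = dslice_hor D I,
     Ver = dslice_ver D I,
     Sqr = dslice_sqr D I,
     hdom = (\<lambda>(x, y, a, \<psi>). x),
     hcod = (\<lambda>(x, y, a, \<psi>). y),
     hid = dslice_hid D,
     hcomp = dslice_hcomp D,
     vdom = (\<lambda>(u, \<gamma>). (vdom D u, sqtop D \<gamma>)),
     vcod = (\<lambda>(u, \<gamma>). (vcod D u, sqbot D \<gamma>)),
     vid = dslice_vid D,
     vcomp = dslice_vcomp D,
     sqtop = (\<lambda>(m, n, k, l, \<alpha>). m),
     sqbot = (\<lambda>(m, n, k, l, \<alpha>). n),
     sqleft = (\<lambda>(m, n, k, l, \<alpha>). k),
     sqright = (\<lambda>(m, n, k, l, \<alpha>). l),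
     hidsq = (\<lambda>(u, \<gamma>). (dslice_hid D (vdom D u, sqtop D \<gamma>), dslice_hid D (vcod D u, sqbot D \<gamma>),
                        (u, \<gamma>), (u, \<gamma>), hidsq D u)),
     hcompsq = (\<lambda>(m, n, k, l, \<alpha>) (m', n', k', l', \<alpha>').
       (dslice_hcomp D m m', dslice_hcomp D n n', k, l', hcompsq D \<alpha> \<alpha>')),
     vidsq = (\<lambda>(x, y, a, \<psi>).
       ((x, y, a, \<psi>), (x, y, a, \<psi>), dslice_vid D x, dslice_vid D y, vidsq D a)),
     vcompsq = (\<lambda>(m, n, k, l, \<alpha>) (m', n', k', l', \<alpha>').
       (m, n', dslice_vcomp D k k', dslice_vcomp D l l', vcompsq D \<alpha> \<alpha>'))\<rparr>"

definition double_slice_proj :: "('o \<times> 'h, ('o, 'h, 's) dslice_hor, 'v \<times> 's,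
    ('o, 'h, 'v, 's) dslice_sqr, 'o, 'h, 'v, 's) dblmap" where
  "double_slice_proj = \<lparr>
     onObj = (\<lambda>(A, f). A),
     onHor = (\<lambda>(x, y, a, \<psi>). a),
     onVer = (\<lambda>(u, \<gamma>). u),
     onSqr = (\<lambda>(m, n, k, l, \<alpha>). \<alpha>)\<rparr>"

definition double_bi_initial :: "('o, 'h, 'v, 's) dblcat \<Rightarrow> 'o \<Rightarrow> bool" where
  "double_bi_initial D I \<longleftrightarrow>
     I \<in> Obj D \<and> double_trivial_fibration (double_pseudo_slice D I) D double_slice_proj"


section \<open>Well-definedness\<close>

text \<open>
  The functor predicates inside \<open>bi_initial\<close> and \<open>double_bi_initial\<close> are never the obstruction:
  for an object \<open>I\<close>, the pseudo-slices are (double) categories and the projections are (double)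
  functors.
\<close>

context two_category begin

lemma homsD: "f \<in> homs C A B \<Longrightarrow> f \<in> Mor C \<and> src C f = A \<and> tgt C f = B \<and> A \<in> Ob C \<and> B \<in> Ob C"
  unfolding homs_def by (auto intro: one.dom_in one.cod_in)

lemma cellsD: "c \<in> cells C f g \<Longrightarrow> c \<in> Cell C \<and> src2 C c = f \<and> tgt2 C c = g \<and>
    f \<in> Mor C \<and> g \<in> Mor C \<and> src C g = src C f \<and> tgt C g = tgt C f"
  unfolding cells_def by (auto intro: vert.dom_in vert.cod_in src_tgt2 tgt_tgt2)

lemma comp1_in: "f \<in> homs C A B \<Longrightarrow> g \<in> homs C B D \<Longrightarrow> comp1 C f g \<in> homs C A D"
  by (simp add: homs_def one.cmp_in one.dom_cmp one.cod_cmp)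

lemma id1_in: "A \<in> Ob C \<Longrightarrow> id1 C A \<in> homs C A A"
  by (simp add: homs_def one.ide_in one.dom_ide one.cod_ide)

lemma id2_in: "f \<in> homs C A B \<Longrightarrow> id2 C f \<in> cells C f f"
  by (simp add: homs_def cells_def vert.ide_in vert.dom_ide vert.cod_ide)

lemma vcomp2_in: "c \<in> cells C f g \<Longrightarrow> d \<in> cells C g h \<Longrightarrow> vcomp2 C c d \<in> cells C f h"
  by (simp add: cells_def vert.cmp_in vert.dom_cmp vert.cod_cmp)

lemma hcomp2_in: "c \<in> cells C f g \<Longrightarrow> d \<in> cells C f' g' \<Longrightarrow> f \<in> homs C A B \<Longrightarrow> f' \<in> homs C B D
   \<Longrightarrow> hcomp2 C c d \<in> cells C (comp1 C f f') (comp1 C g g')"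
  by (simp add: cells_def homs_def horiz.cmp_in src2_hcomp2 tgt2_hcomp2)

lemma vassoc: "c \<in> cells C f g \<Longrightarrow> d \<in> cells C g h \<Longrightarrow> e \<in> cells C h k \<Longrightarrow>
   vcomp2 C (vcomp2 C c d) e = vcomp2 C c (vcomp2 C d e)"
  by (simp add: cells_def vert.cmp_assoc)

lemma hassoc: "c \<in> cells C f f' \<Longrightarrow> d \<in> cells C g g' \<Longrightarrow> e \<in> cells C h h' \<Longrightarrow>
   f \<in> homs C A B \<Longrightarrow> g \<in> homs C B D \<Longrightarrow> h \<in> homs C D E \<Longrightarrow>
   hcomp2 C (hcomp2 C c d) e = hcomp2 C c (hcomp2 C d e)"
  by (simp add: cells_def homs_def horiz.cmp_assoc)

lemma vidl: "c \<in> cells C f g \<Longrightarrow> vcomp2 C (id2 C f) c = c"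
  using vert.ide_cmp by (auto simp: cells_def)
lemma vidr: "c \<in> cells C f g \<Longrightarrow> vcomp2 C c (id2 C g) = c"
  using vert.cmp_ide by (auto simp: cells_def)
lemma hidl: "c \<in> cells C f g \<Longrightarrow> f \<in> homs C A B \<Longrightarrow> hcomp2 C (id2 C (id1 C A)) c = c"
  using horiz.ide_cmp by (auto simp: cells_def homs_def)
lemma hidr: "c \<in> cells C f g \<Longrightarrow> f \<in> homs C A B \<Longrightarrow> hcomp2 C c (id2 C (id1 C B)) = c"
  using horiz.cmp_ide by (auto simp: cells_def homs_def)
lemma cells_homs: "c \<in> cells C f g \<Longrightarrow> f \<in> homs C A B \<Longrightarrow> g \<in> homs C A B"
  by (drule cellsD) (auto simp: homs_def)

lemma inter: assumes "c \<in> cells C f g" "d \<in> cells C f' g'" "c' \<in> cells C g h" "d' \<in> cells C g' h'"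
   "f \<in> homs C A B" "f' \<in> homs C B D" shows
   "vcomp2 C (hcomp2 C c d) (hcomp2 C c' d') = hcomp2 C (vcomp2 C c c') (vcomp2 C d d')"
  by (rule interchange2) (use assms cells_homs[OF assms(1,5)] cells_homs[OF assms(2,6)] in \<open>auto simp: cells_def homs_def\<close>)
lemma idc: "f \<in> homs C A B \<Longrightarrow> g \<in> homs C B D \<Longrightarrow> id2 C (comp1 C f g) = hcomp2 C (id2 C f) (id2 C g)"
  using id2_comp1 by (auto simp: homs_def)
lemma invI: "c \<in> cells C f g \<Longrightarrow> d \<in> cells C g f \<Longrightarrow> vcomp2 C c d = id2 C f \<Longrightarrow> vcomp2 C d c = id2 C g \<Longrightarrow> invertible2 C c"
  unfolding invertible2_def by (auto simp: cells_def)
lemma inv_id: "f \<in> homs C A B \<Longrightarrow> invertible2 C (id2 C f)"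
  by (rule invI[where f=f and g=f and d="id2 C f"]) (simp_all add: id2_in vidl[of _ f f])
lemma invE: "c \<in> cells C f g \<Longrightarrow> invertible2 C c \<Longrightarrow> \<exists>d \<in> cells C g f. vcomp2 C c d = id2 C f \<and> vcomp2 C d c = id2 C g"
  unfolding invertible2_def by (auto simp: cells_def)

lemma inv_v: assumes "c \<in> cells C f g" "d \<in> cells C g h" "invertible2 C c" "invertible2 C d"
  shows "invertible2 C (vcomp2 C c d)"
proof -
  obtain c' where c': "c' \<in> cells C g f" "vcomp2 C c c' = id2 C f" "vcomp2 C c' c = id2 C g" using invE[OF assms(1,3)] by blast
  obtain d' where d': "d' \<in> cells C h g" "vcomp2 C d d' = id2 C g" "vcomp2 C d' d = id2 C h" using invE[OF assms(2,4)] by blast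
  show ?thesis
  proof (rule invI)
    show "vcomp2 C c d \<in> cells C f h" using vcomp2_in[OF assms(1,2)] .
    show "vcomp2 C d' c' \<in> cells C h f" using vcomp2_in[OF d'(1) c'(1)] .
    show "vcomp2 C (vcomp2 C c d) (vcomp2 C d' c') = id2 C f"
      using vassoc[OF assms(1,2) vcomp2_in[OF d'(1) c'(1)]] vassoc[OF assms(2) d'(1) c'(1)] vidl[OF c'(1)] c' d' by simp
    show "vcomp2 C (vcomp2 C d' c') (vcomp2 C c d) = id2 C h"
      using vassoc[OF d'(1) c'(1) vcomp2_in[OF assms(1,2)]] vassoc[OF c'(1) assms(1,2)] vidl[OF assms(2)] c' d' by simp
  qed
qed

lemma cassoc: "f \<in> homs C A B \<Longrightarrow> g \<in> homs C B D \<Longrightarrow> h \<in> homs C D E \<Longrightarrow> comp1 C (comp1 C f g) h = comp1 C f (comp1 C g h)"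
  by (simp add: homs_def one.cmp_assoc)

lemma inv_h: assumes "c \<in> cells C f g" "f \<in> homs C A B" "b \<in> homs C B D" "invertible2 C c"
  shows "invertible2 C (hcomp2 C c (id2 C b))"
proof -
  obtain c' where c': "c' \<in> cells C g f" "vcomp2 C c c' = id2 C f" "vcomp2 C c' c = id2 C g" using invE[OF assms(1,4)] by blast
  note g = cells_homs[OF assms(1,2)]
  note b = id2_in[OF assms(3)]
  show ?thesis
  proof (rule invI)
    show "hcomp2 C c (id2 C b) \<in> cells C (comp1 C f b) (comp1 C g b)" by (rule hcomp2_in[OF assms(1) b assms(2,3)])
    show "hcomp2 C c' (id2 C b) \<in> cells C (comp1 C g b) (comp1 C f b)" by (rule hcomp2_in[OF c'(1) b g assms(3)])
    show "vcomp2 C (hcomp2 C c (id2 C b)) (hcomp2 C c' (id2 C b)) = id2 C (comp1 C f b)"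
      using inter[OF assms(1) b c'(1) b assms(2,3)] c' vidl[OF b] idc[OF assms(2,3)] by simp
    show "vcomp2 C (hcomp2 C c' (id2 C b)) (hcomp2 C c (id2 C b)) = id2 C (comp1 C g b)"
      using inter[OF c'(1) b assms(1) b g assms(3)] c' vidl[OF b] idc[OF g assms(3)] by simp
  qed
qed

lemma smor_iff: "((A, f), (A', f'), a, p) \<in> slice_mor C I \<longleftrightarrow> f \<in> homs C I A \<and> f' \<in> homs C I A' \<and> a \<in> homs C A A' \<and> p \<in> cells C f' (comp1 C f a) \<and> invertible2 C p"
  by (auto simp: slice_mor_def slice_ob_def dest: homsD)

lemma smor_comp:
  assumes "((A, f), (A', f'), a, p) \<in> slice_mor C I" "((A', f'), (B, g), b, q) \<in> slice_mor C I"
  shows "((A, f), (B, g), comp1 C a b, vcomp2 C q (hcomp2 C p (id2 C b))) \<in> slice_mor C I"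
proof -
  have 1: "f \<in> homs C I A" "f' \<in> homs C I A'" "a \<in> homs C A A'" "p \<in> cells C f' (comp1 C f a)" "invertible2 C p"
    "g \<in> homs C I B" "b \<in> homs C A' B" "q \<in> cells C g (comp1 C f' b)" "invertible2 C q"
    using assms unfolding smor_iff by auto
  have "hcomp2 C p (id2 C b) \<in> cells C (comp1 C f' b) (comp1 C (comp1 C f a) b)"
    by (rule hcomp2_in[OF 1(4) id2_in[OF 1(7)] 1(2,7)])
  moreover have "comp1 C (comp1 C f a) b = comp1 C f (comp1 C a b)"
    using 1 by (blast intro: cassoc)
  ultimately have 2: "hcomp2 C p (id2 C b) \<in> cells C (comp1 C f' b) (comp1 C f (comp1 C a b))" by simp
  show ?thesis unfolding smor_iff
    using 1 inv_v[OF 1(8) 2 1(9) inv_h[OF 1(4,2,7,5)]] vcomp2_in[OF 1(8) 2] comp1_in[OF 1(3,7)] by simp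
qed

lemma smor_assoc:
  assumes "((A, f), (A', f'), a, p) \<in> slice_mor C I" "((A', f'), (B, g), b, q) \<in> slice_mor C I"
   "((B, g), (B', g'), c, r) \<in> slice_mor C I"
  shows "vcomp2 C r (hcomp2 C (vcomp2 C q (hcomp2 C p (id2 C b))) (id2 C c)) =
     vcomp2 C (vcomp2 C r (hcomp2 C q (id2 C c))) (hcomp2 C p (id2 C (comp1 C b c)))"
proof -
  have 1: "f \<in> homs C I A" "f' \<in> homs C I A'" "a \<in> homs C A A'" "p \<in> cells C f' (comp1 C f a)"
    "g \<in> homs C I B" "b \<in> homs C A' B" "q \<in> cells C g (comp1 C f' b)"
     "g' \<in> homs C I B'" "c \<in> homs C B B'" "r \<in> cells C g' (comp1 C g c)"
    using assms unfolding smor_iff by auto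
  note b = id2_in[OF 1(6)] and c = id2_in[OF 1(9)]
  note pb = hcomp2_in[OF 1(4) b 1(2,6)]
  note bb = hcomp2_in[OF b c 1(6,9)]
  have as: "comp1 C (comp1 C f' b) c = comp1 C f' (comp1 C b c)"
    using 1 by (blast intro: cassoc)
  have "hcomp2 C (vcomp2 C q (hcomp2 C p (id2 C b))) (id2 C c) = vcomp2 C (hcomp2 C q (id2 C c)) (hcomp2 C (hcomp2 C p (id2 C b)) (id2 C c))"
    using inter[OF 1(7) c pb c 1(5,9)] vidl[OF c] by simp
  also have "hcomp2 C (hcomp2 C p (id2 C b)) (id2 C c) = hcomp2 C p (id2 C (comp1 C b c))"
    using hassoc[OF 1(4) b c 1(2,6,9)] idc[OF 1(6,9)] by simp
  finally have 2: "hcomp2 C (vcomp2 C q (hcomp2 C p (id2 C b))) (id2 C c) = vcomp2 C (hcomp2 C q (id2 C c)) (hcomp2 C p (id2 C (comp1 C b c)))" .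
  have qc: "hcomp2 C q (id2 C c) \<in> cells C (comp1 C g c) (comp1 C f' (comp1 C b c))"
    using hcomp2_in[OF 1(7) c 1(5,9)] as by simp
  show ?thesis unfolding 2
    using vassoc[OF 1(10) qc hcomp2_in[OF 1(4) id2_in[OF comp1_in[OF 1(6,9)]] 1(2) comp1_in[OF 1(6,9)]]] by simp
qed

lemma scell_iff: "(((A,f),(A',f'),a,p),((B,g),(B',g'),b,q),\<beta>) \<in> slice_cell C I \<longleftrightarrow>
   ((A, f), (A', f'), a, p) \<in> slice_mor C I \<and> ((B, g), (B', g'), b, q) \<in> slice_mor C I \<and> A = B \<and> f = g \<and> A' = B' \<and> f' = g' \<and>
   \<beta> \<in> cells C a b \<and> vcomp2 C p (hcomp2 C (id2 C f) \<beta>) = q"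
  by (auto simp: slice_cell_def)

lemma smor_idl: "((A, f), (A', f'), a, p) \<in> slice_mor C I \<Longrightarrow> vcomp2 C p (hcomp2 C (id2 C f) (id2 C a)) = p"
  unfolding smor_iff using idc[of f I A a A'] vidr[of p f' "comp1 C f a"] by simp
lemma smor_idr: "((A, f), (A', f'), a, p) \<in> slice_mor C I \<Longrightarrow> vcomp2 C (id2 C f') (hcomp2 C p (id2 C (id1 C A'))) = p"
  unfolding smor_iff using hidr[of p f' "comp1 C f a" I A'] vidl[of p f' "comp1 C f a"] by simp
lemma cunr: "f \<in> homs C I A \<Longrightarrow> comp1 C f (id1 C A) = f"
  using one.cmp_ide by (auto simp: homs_def)
lemma smor_id: "A \<in> Ob C \<Longrightarrow> f \<in> homs C I A \<Longrightarrow> ((A,f),(A,f),id1 C A, id2 C f) \<in> slice_mor C I"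
  unfolding smor_iff by (simp add: id1_in id2_in inv_id cunr)

lemma scell_h:
  assumes "((A, f), (A', f'), a, p) \<in> slice_mor C I" "((A', f'), (B, g), b, q) \<in> slice_mor C I"
   "((A, f), (A', f'), a', p') \<in> slice_mor C I" "((A', f'), (B, g), b', q') \<in> slice_mor C I"
   "\<alpha> \<in> cells C a a'" "\<beta> \<in> cells C b b'" "vcomp2 C p (hcomp2 C (id2 C f) \<alpha>) = p'"
    "vcomp2 C q (hcomp2 C (id2 C f') \<beta>) = q'"
  shows "vcomp2 C (vcomp2 C q (hcomp2 C p (id2 C b))) (hcomp2 C (id2 C f) (hcomp2 C \<alpha> \<beta>))
   = vcomp2 C q' (hcomp2 C p' (id2 C b'))"
proof -
  have 1: "f \<in> homs C I A" "f' \<in> homs C I A'" "a \<in> homs C A A'" "p \<in> cells C f' (comp1 C f a)"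
    "g \<in> homs C I B" "b \<in> homs C A' B" "q \<in> cells C g (comp1 C f' b)"
    "a' \<in> homs C A A'" "p' \<in> cells C f' (comp1 C f a')"
    "b' \<in> homs C A' B" "q' \<in> cells C g (comp1 C f' b')"
    using assms unfolding smor_iff by auto
  note F = id2_in[OF 1(1)] and F' = id2_in[OF 1(2)] and b = id2_in[OF 1(6)] and b' = id2_in[OF 1(10)]
  note fa = hcomp2_in[OF F assms(5) 1(1,3)]
  have "comp1 C (comp1 C f a) b = comp1 C f (comp1 C a b)" 
    using 1 by (blast intro: cassoc)
  hence pb: "hcomp2 C p (id2 C b) \<in> cells C (comp1 C f' b) (comp1 C f (comp1 C a b))"
    using hcomp2_in[OF 1(4) b 1(2,6)] by simp
  note fab = hcomp2_in[OF F hcomp2_in[OF assms(5,6) 1(3,6)] 1(1) comp1_in[OF 1(3,6)]]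
  have "vcomp2 C (hcomp2 C p (id2 C b)) (hcomp2 C (id2 C f) (hcomp2 C \<alpha> \<beta>)) =
     vcomp2 C (hcomp2 C p (id2 C b)) (hcomp2 C (hcomp2 C (id2 C f) \<alpha>) \<beta>)"
    using hassoc[OF F assms(5,6) 1(1,3,6)] by simp
  also have "\<dots> = hcomp2 C p' \<beta>" using inter[OF 1(4) b fa assms(6) 1(2,6)] assms(7) vidl[OF assms(6)] by simp
  also have "\<dots> = vcomp2 C (hcomp2 C (id2 C f') \<beta>) (hcomp2 C p' (id2 C b'))"
    using inter[OF F' assms(6) 1(9) b' 1(2,6)] vidl[OF 1(9)] vidr[OF assms(6)] by simp
  finally show ?thesis
    using vassoc[OF 1(7) pb fab] vassoc[OF 1(7) hcomp2_in[OF F' assms(6) 1(2,6)] hcomp2_in[OF 1(9) b' 1(2,10)]] assms(8)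
    by simp
qed

lemma scell_v:
  assumes "((A, f), (A', f'), a, p) \<in> slice_mor C I" "\<alpha> \<in> cells C a b" "\<beta> \<in> cells C b c"
  shows "vcomp2 C (vcomp2 C p (hcomp2 C (id2 C f) \<alpha>)) (hcomp2 C (id2 C f) \<beta>) = vcomp2 C p (hcomp2 C (id2 C f) (vcomp2 C \<alpha> \<beta>))"
proof -
  have 1: "f \<in> homs C I A" "f' \<in> homs C I A'" "a \<in> homs C A A'" "p \<in> cells C f' (comp1 C f a)"
    using assms unfolding smor_iff by auto
  note F = id2_in[OF 1(1)]
  note b = cells_homs[OF assms(2) 1(3)]
  show ?thesis
    using inter[OF F assms(2) F assms(3) 1(1,3)] vidl[OF F]
     vassoc[OF 1(4) hcomp2_in[OF F assms(2) 1(1,3)] hcomp2_in[OF F assms(3) 1(1) b]] by simp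
qed

lemma two_category_pseudo_slice: assumes "I \<in> Ob C" shows "two_category (pseudo_slice C I)"
proof -
  have cmpd: "comp1 C (comp1 C f a) b = comp1 C f (comp1 C a b)"
    if "f \<in> homs C A B" "a \<in> homs C B D" "b \<in> homs C D E" for f a b A B D E
    using that one.cmp_assoc unfolding homs_def by auto
  have un: "comp1 C (id1 C A) a = a" "comp1 C a (id1 C B) = a" if "a \<in> homs C A B" for a A B
    using that one.cmp_ide one.ide_cmp unfolding homs_def by auto
  note S = pseudo_slice_def slice_comp1_def
  show ?thesis
    apply (unfold_locales)
    apply (auto simp: S scell_iff smor_comp smor_id smor_idl smor_idr smor_assoc scell_v id1_in
       vcomp2_in vidl vidr vassoc)
    apply (auto simp: slice_mor_def slice_ob_def id1_in id2_in un cunr cmpd vidl[OF id2_in] hidr[OF id2_in] hidl hidr hassoc idc inter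
        intro: inv_id id2_in id1_in hcomp2_in scell_h[OF _ _ _ _ _ _ refl refl])
  done
qed

lemma two_functor_slice_proj: assumes "I \<in> Ob C" shows "two_functor (pseudo_slice C I) C slice_proj"
proof -
  interpret S: two_category "pseudo_slice C I" using two_category_pseudo_slice[OF assms] .
  show ?thesis
    by unfold_locales
      (auto simp: pseudo_slice_def slice_comp1_def slice_proj_def slice_ob_def homs_def slice_mor_def cells_def slice_cell_def)
qed
end

context double_category begin

lemma hhomsD: "f \<in> hhoms D A B \<Longrightarrow> A \<in> Obj D \<and> B \<in> Obj D"
  unfolding hhoms_def by (auto intro: hor.dom_in hor.cod_in)

lemma hcomp_in: "f \<in> hhoms D A B \<Longrightarrow> g \<in> hhoms D B E \<Longrightarrow> hcomp D f g \<in> hhoms D A E"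
  by (simp add: hhoms_def hor.cmp_in hor.dom_cmp hor.cod_cmp)
lemma hid_in: "A \<in> Obj D \<Longrightarrow> hid D A \<in> hhoms D A A"
  by (simp add: hhoms_def hor.ide_in hor.dom_ide hor.cod_ide)
lemma cassoc: "f \<in> hhoms D A B \<Longrightarrow> g \<in> hhoms D B E \<Longrightarrow> h \<in> hhoms D E F \<Longrightarrow> hcomp D (hcomp D f g) h = hcomp D f (hcomp D g h)"
  by (simp add: hhoms_def hor.cmp_assoc)
lemma cunr: "f \<in> hhoms D I A \<Longrightarrow> hcomp D f (hid D A) = f"
  using hor.cmp_ide by (auto simp: hhoms_def)
lemma cunl: "f \<in> hhoms D I A \<Longrightarrow> hcomp D (hid D I) f = f"
  using hor.ide_cmp by (auto simp: hhoms_def)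
lemma vcomp_in: "f \<in> vhoms D A B \<Longrightarrow> g \<in> vhoms D B E \<Longrightarrow> vcomp D f g \<in> vhoms D A E"
  by (simp add: vhoms_def ver.cmp_in ver.dom_cmp ver.cod_cmp)
lemma vid_in: "A \<in> Obj D \<Longrightarrow> vid D A \<in> vhoms D A A"
  by (simp add: vhoms_def ver.ide_in ver.dom_ide ver.cod_ide)
lemma vass: "f \<in> vhoms D A B \<Longrightarrow> g \<in> vhoms D B E \<Longrightarrow> h \<in> vhoms D E F \<Longrightarrow> vcomp D (vcomp D f g) h = vcomp D f (vcomp D g h)"
  by (simp add: vhoms_def ver.cmp_assoc)
lemma vunr: "f \<in> vhoms D I A \<Longrightarrow> vcomp D f (vid D A) = f"
  using ver.cmp_ide by (auto simp: vhoms_def)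
lemma vunl: "f \<in> vhoms D I A \<Longrightarrow> vcomp D (vid D I) f = f"
  using ver.ide_cmp by (auto simp: vhoms_def)

lemma vsq_in: "s \<in> squares D a b u v \<Longrightarrow> t \<in> squares D b c u' v' \<Longrightarrow> vcompsq D s t \<in> squares D a c (vcomp D u u') (vcomp D v v')"
  by (simp add: squares_def vsq.cmp_in vsq.dom_cmp vsq.cod_cmp sqleft_vcompsq sqright_vcompsq)
lemma hsq_in: "s \<in> squares D a b u v \<Longrightarrow> t \<in> squares D a' b' v w \<Longrightarrow> hcompsq D s t \<in> squares D (hcomp D a a') (hcomp D b b') u w"
  by (simp add: squares_def hsq.cmp_in hsq.dom_cmp hsq.cod_cmp sqtop_hcompsq sqbot_hcompsq)
lemma vidsq_in: "a \<in> hhoms D A B \<Longrightarrow> vidsq D a \<in> squares D a a (vid D A) (vid D B)"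
  by (simp add: squares_def hhoms_def vsq.ide_in vsq.dom_ide vsq.cod_ide sqleft_vidsq sqright_vidsq)
lemma hidsq_in: "u \<in> vhoms D A B \<Longrightarrow> hidsq D u \<in> squares D (hid D A) (hid D B) u u"
  by (simp add: squares_def vhoms_def hsq.ide_in hsq.dom_ide hsq.cod_ide sqtop_hidsq sqbot_hidsq)

lemma vassoc: "c \<in> squares D f g u v \<Longrightarrow> d \<in> squares D g h u' v' \<Longrightarrow> e \<in> squares D h k u'' v'' \<Longrightarrow>
   vcompsq D (vcompsq D c d) e = vcompsq D c (vcompsq D d e)"
  by (simp add: squares_def vsq.cmp_assoc)
lemma hassoc: "c \<in> squares D f f' u v \<Longrightarrow> d \<in> squares D g g' v w \<Longrightarrow> e \<in> squares D h h' w x \<Longrightarrow>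
   hcompsq D (hcompsq D c d) e = hcompsq D c (hcompsq D d e)"
  by (simp add: squares_def hsq.cmp_assoc)
lemma vidl: "c \<in> squares D f g u v \<Longrightarrow> vcompsq D (vidsq D f) c = c"
  using vsq.ide_cmp by (auto simp: squares_def)
lemma vidr: "c \<in> squares D f g u v \<Longrightarrow> vcompsq D c (vidsq D g) = c"
  using vsq.cmp_ide by (auto simp: squares_def)
lemma hidl': "c \<in> squares D f g u v \<Longrightarrow> hcompsq D (hidsq D u) c = c"
  using hsq.ide_cmp by (auto simp: squares_def)
lemma hidr': "c \<in> squares D f g u v \<Longrightarrow> hcompsq D c (hidsq D v) = c"
  using hsq.cmp_ide by (auto simp: squares_def)
lemma hidl: "c \<in> squares D f g (vid D A) v \<Longrightarrow> A \<in> Obj D \<Longrightarrow> hcompsq D (vidsq D (hid D A)) c = c"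
  using hidl'[of c f g "vid D A" v] hidsq_vid by simp
lemma hidr: "c \<in> squares D f g u (vid D A) \<Longrightarrow> A \<in> Obj D \<Longrightarrow> hcompsq D c (vidsq D (hid D A)) = c"
  using hidr'[of c f g u "vid D A"] hidsq_vid by simp
lemma inter: "s \<in> squares D a b u v \<Longrightarrow> t \<in> squares D a' b' v w \<Longrightarrow> s' \<in> squares D b c u' v' \<Longrightarrow> t' \<in> squares D b' c' v' w' \<Longrightarrow>
   vcompsq D (hcompsq D s t) (hcompsq D s' t') = hcompsq D (vcompsq D s s') (vcompsq D t t')"
  by (simp add: squares_def interchange)
lemma idc: "f \<in> hhoms D A B \<Longrightarrow> g \<in> hhoms D B E \<Longrightarrow> vidsq D (hcomp D f g) = hcompsq D (vidsq D f) (vidsq D g)"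
  using vidsq_hcomp by (auto simp: hhoms_def)
lemma hidc: "u \<in> vhoms D A B \<Longrightarrow> v \<in> vhoms D B E \<Longrightarrow> hidsq D (vcomp D u v) = vcompsq D (hidsq D u) (hidsq D v)"
  using hidsq_vcomp by (auto simp: vhoms_def)

lemma vidvid: "A \<in> Obj D \<Longrightarrow> vcomp D (vid D A) (vid D A) = vid D A"
  by (simp add: vunl[OF vid_in])

lemma invI: "c \<in> squares D f g (vid D A) (vid D B) \<Longrightarrow> f \<in> hhoms D A B \<Longrightarrow> d \<in> squares D g f u v \<Longrightarrow> vcompsq D c d = vidsq D f \<Longrightarrow> vcompsq D d c = vidsq D g \<Longrightarrow> vert_invertible D c"
  unfolding vert_invertible_def by (auto simp: squares_def hhoms_def)
lemma vid_inj: "vid D A = vid D B \<Longrightarrow> A \<in> Obj D \<Longrightarrow> B \<in> Obj D \<Longrightarrow> A = B"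
  by (metis ver.dom_ide)
lemma invE: assumes "c \<in> squares D f g (vid D A) (vid D B)" "f \<in> hhoms D A B" "vert_invertible D c"
  shows "\<exists>d \<in> squares D g f (vid D A) (vid D B). vcompsq D c d = vidsq D f \<and> vcompsq D d c = vidsq D g"
proof -
  obtain d where d: "d \<in> Sqr D" "sqtop D d = g" "sqbot D d = f" "vcompsq D c d = vidsq D f" "vcompsq D d c = vidsq D g"
    using assms unfolding vert_invertible_def squares_def by auto
  have AB: "A \<in> Obj D" "B \<in> Obj D" using hhomsD[OF assms(2)] by auto
  have c: "c \<in> Sqr D" "sqbot D c = sqtop D d" "sqleft D c = vid D A" "sqright D c = vid D B" "hdom D (sqbot D c) = A" "hcod D (sqbot D c) = B"
    using assms d hdom_sqbot[of c] hcod_sqbot[of c] AB by (auto simp: squares_def ver.cod_ide)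
  have vl: "vdom D (sqleft D d) = A" "vdom D (sqright D d) = B" using hdom_sqtop[OF d(1)] hcod_sqtop[OF d(1)] c by auto
  have "vcomp D (vid D A) (sqleft D d) = vid D A" using sqleft_vcompsq[OF c(1) d(1) c(2)] d(4) c sqleft_vidsq[of f] assms(2) by (simp add: hhoms_def)
  hence "sqleft D d = vid D A" using ver.ide_cmp[of "sqleft D d"] vl hsq.dom_in[OF d(1)] by simp
  moreover have "vcomp D (vid D B) (sqright D d) = vid D B" using sqright_vcompsq[OF c(1) d(1) c(2)] d(4) c sqright_vidsq[of f] assms(2) by (simp add: hhoms_def)
  hence "sqright D d = vid D B" using ver.ide_cmp[of "sqright D d"] vl hsq.cod_in[OF d(1)] by simp
  ultimately show ?thesis using d by (auto simp: squares_def)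
qed

lemma inv_id: "f \<in> hhoms D A B \<Longrightarrow> vert_invertible D (vidsq D f)"
  by (rule invI[OF vidsq_in _ vidsq_in]) (auto simp: vidl[OF vidsq_in])

lemma sq_hom: "c \<in> squares D f g (vid D A) (vid D B) \<Longrightarrow> f \<in> hhoms D A B \<Longrightarrow> g \<in> hhoms D A B"
  using hdom_sqbot[of c] hcod_sqbot[of c] hhomsD[of f A B] vsq.cod_in[of c]
  by (auto simp: squares_def hhoms_def ver.cod_ide)

lemma inv_v: assumes "c \<in> squares D f g (vid D A) (vid D B)" "d \<in> squares D g h (vid D A) (vid D B)" "f \<in> hhoms D A B" "vert_invertible D c" "vert_invertible D d"
  shows "vert_invertible D (vcompsq D c d)"
proof -
  note g = sq_hom[OF assms(1,3)]
  have AB: "A \<in> Obj D" "B \<in> Obj D" using hhomsD[OF assms(3)] by auto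
  obtain c' where c': "c' \<in> squares D g f (vid D A) (vid D B)" "vcompsq D c c' = vidsq D f" "vcompsq D c' c = vidsq D g" using invE[OF assms(1,3,4)] by blast
  obtain d' where d': "d' \<in> squares D h g (vid D A) (vid D B)" "vcompsq D d d' = vidsq D g" "vcompsq D d' d = vidsq D h" using invE[OF assms(2) g assms(5)] by blast
  show ?thesis
  proof (rule invI[OF _ assms(3)])
    show "vcompsq D c d \<in> squares D f h (vid D A) (vid D B)" using vsq_in[OF assms(1,2)] AB by (simp add: vidvid)
    show "vcompsq D d' c' \<in> squares D h f (vid D A) (vid D B)" using vsq_in[OF d'(1) c'(1)] AB by (simp add: vidvid)
    show "vcompsq D (vcompsq D c d) (vcompsq D d' c') = vidsq D f"
      using vassoc[OF assms(1,2) vsq_in[OF d'(1) c'(1)]] vassoc[OF assms(2) d'(1) c'(1)] vidl[OF c'(1)] c' d' by simp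
    show "vcompsq D (vcompsq D d' c') (vcompsq D c d) = vidsq D h"
      using vassoc[OF d'(1) c'(1) vsq_in[OF assms(1,2)]] vassoc[OF c'(1) assms(1,2)] vidl[OF assms(2)] c' d' by simp
  qed
qed

lemma inv_h: assumes "c \<in> squares D f g (vid D A) (vid D B)" "f \<in> hhoms D A B" "b \<in> hhoms D B E" "vert_invertible D c"
  shows "vert_invertible D (hcompsq D c (vidsq D b))"
proof -
  obtain c' where c': "c' \<in> squares D g f (vid D A) (vid D B)" "vcompsq D c c' = vidsq D f" "vcompsq D c' c = vidsq D g" using invE[OF assms(1,2,4)] by blast
  note g = sq_hom[OF assms(1,2)]
  note b = vidsq_in[OF assms(3)]
  show ?thesis
  proof (rule invI[OF _ hcomp_in[OF assms(2,3)]])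
    show "hcompsq D c (vidsq D b) \<in> squares D (hcomp D f b) (hcomp D g b) (vid D A) (vid D E)" by (rule hsq_in[OF assms(1) b])
    show "hcompsq D c' (vidsq D b) \<in> squares D (hcomp D g b) (hcomp D f b) (vid D A) (vid D E)" by (rule hsq_in[OF c'(1) b])
    show "vcompsq D (hcompsq D c (vidsq D b)) (hcompsq D c' (vidsq D b)) = vidsq D (hcomp D f b)"
      using inter[OF assms(1) b c'(1) b] c' vidl[OF b] idc[OF assms(2,3)] by simp
    show "vcompsq D (hcompsq D c' (vidsq D b)) (hcompsq D c (vidsq D b)) = vidsq D (hcomp D g b)"
      using inter[OF c'(1) b assms(1) b] c' vidl[OF b] idc[OF g assms(3)] by simp
  qed
qed

lemma smor_iff: "((A, f), (A', f'), a, p) \<in> dslice_hor D I \<longleftrightarrow> f \<in> hhoms D I A \<and> f' \<in> hhoms D I A' \<and> a \<in> hhoms D A A' \<and> p \<in> squares D f' (hcomp D f a) (vid D I) (vid D A') \<and> vert_invertible D p"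
  by (auto simp: dslice_hor_def dslice_obj_def dest: hhomsD)

lemma smor_comp:
  assumes "((A, f), (A', f'), a, p) \<in> dslice_hor D I" "((A', f'), (B, g), b, q) \<in> dslice_hor D I"
  shows "((A, f), (B, g), hcomp D a b, vcompsq D q (hcompsq D p (vidsq D b))) \<in> dslice_hor D I"
proof -
  have 1: "f \<in> hhoms D I A" "f' \<in> hhoms D I A'" "a \<in> hhoms D A A'" "p \<in> squares D f' (hcomp D f a) (vid D I) (vid D A')" "vert_invertible D p"
    "g \<in> hhoms D I B" "b \<in> hhoms D A' B" "q \<in> squares D g (hcomp D f' b) (vid D I) (vid D B)" "vert_invertible D q"
    using assms unfolding smor_iff by auto
  have O: "I \<in> Obj D" "B \<in> Obj D" using hhomsD[OF 1(6)] by auto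
  have 2: "hcompsq D p (vidsq D b) \<in> squares D (hcomp D f' b) (hcomp D f (hcomp D a b)) (vid D I) (vid D B)" 
    using hsq_in[OF 1(4) vidsq_in[OF 1(7)]] cassoc[OF 1(1,3,7)] by simp
  show ?thesis unfolding smor_iff
    using 1 inv_v[OF 1(8) 2 1(6) 1(9) inv_h[OF 1(4,2,7,5)]] vsq_in[OF 1(8) 2] hcomp_in[OF 1(3,7)] by (simp add: vidvid O)
qed

lemma smor_assoc:
  assumes "((A, f), (A', f'), a, p) \<in> dslice_hor D I" "((A', f'), (B, g), b, q) \<in> dslice_hor D I"
   "((B, g), (B', g'), c, r) \<in> dslice_hor D I"
  shows "vcompsq D r (hcompsq D (vcompsq D q (hcompsq D p (vidsq D b))) (vidsq D c)) =
     vcompsq D (vcompsq D r (hcompsq D q (vidsq D c))) (hcompsq D p (vidsq D (hcomp D b c)))"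
proof -
  have 1: "f \<in> hhoms D I A" "f' \<in> hhoms D I A'" "a \<in> hhoms D A A'" "p \<in> squares D f' (hcomp D f a) (vid D I) (vid D A')"
    "g \<in> hhoms D I B" "b \<in> hhoms D A' B" "q \<in> squares D g (hcomp D f' b) (vid D I) (vid D B)"
     "g' \<in> hhoms D I B'" "c \<in> hhoms D B B'" "r \<in> squares D g' (hcomp D g c) (vid D I) (vid D B')"
    using assms unfolding smor_iff by auto
  note b = vidsq_in[OF 1(6)] and c = vidsq_in[OF 1(9)]
  note pb = hsq_in[OF 1(4) b]
  have "hcompsq D (vcompsq D q (hcompsq D p (vidsq D b))) (vidsq D c) = vcompsq D (hcompsq D q (vidsq D c)) (hcompsq D (hcompsq D p (vidsq D b)) (vidsq D c))"
    using inter[OF 1(7) c pb c] vidl[OF c] by simp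
  also have "hcompsq D (hcompsq D p (vidsq D b)) (vidsq D c) = hcompsq D p (vidsq D (hcomp D b c))"
    using hassoc[OF 1(4) b c] idc[OF 1(6,9)] by simp
  finally have 2: "hcompsq D (vcompsq D q (hcompsq D p (vidsq D b))) (vidsq D c) = vcompsq D (hcompsq D q (vidsq D c)) (hcompsq D p (vidsq D (hcomp D b c)))" .
  have qc: "hcompsq D q (vidsq D c) \<in> squares D (hcomp D g c) (hcomp D f' (hcomp D b c)) (vid D I) (vid D B')"
    using hsq_in[OF 1(7) c] cassoc[OF 1(2,6,9)] by simp
  show ?thesis unfolding 2
    using vassoc[OF 1(10) qc hsq_in[OF 1(4) vidsq_in[OF hcomp_in[OF 1(6,9)]]]] by simp
qed

lemma smor_idl: "((A, f), (A', f'), a, p) \<in> dslice_hor D I \<Longrightarrow> vcompsq D p (hcompsq D (vidsq D f) (vidsq D a)) = p"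
  unfolding smor_iff using idc[of f I A a A'] vidr[of p f' "hcomp D f a"] by auto
lemma smor_idr: "((A, f), (A', f'), a, p) \<in> dslice_hor D I \<Longrightarrow> vcompsq D (vidsq D f') (hcompsq D p (vidsq D (hid D A'))) = p"
  unfolding smor_iff using hidr[of p f' "hcomp D f a" _ A'] vidl[of p f' "hcomp D f a"] hhomsD[of f' I A'] by auto
lemma smor_idl': "((A, f), (A', f'), a, p) \<in> dslice_hor D I \<Longrightarrow> vcompsq D (vidsq D f') p = p"
  unfolding smor_iff using vidl[of p f' "hcomp D f a"] by auto
lemma smor_id: "A \<in> Obj D \<Longrightarrow> f \<in> hhoms D I A \<Longrightarrow> ((A,f),(A,f),hid D A, vidsq D f) \<in> dslice_hor D I"
  unfolding smor_iff by (simp add: hid_in vidsq_in inv_id cunr)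

lemma ssq_iff: "(((A, f), (A', f'), a, \<psi>), ((B, g), (B', g'), b, \<phi>), (u, \<gamma>), (u', \<gamma>'), \<alpha>) \<in> dslice_sqr D I \<longleftrightarrow>
       ((A, f), (A', f'), a, \<psi>) \<in> dslice_hor D I \<and> ((B, g), (B', g'), b, \<phi>) \<in> dslice_hor D I \<and>
       u \<in> vhoms D A B \<and> \<gamma> \<in> squares D f g (vid D I) u \<and>
       u' \<in> vhoms D A' B' \<and> \<gamma>' \<in> squares D f' g' (vid D I) u' \<and>
       \<alpha> \<in> squares D a b u u' \<and>
       vcompsq D \<psi> (hcompsq D \<gamma> \<alpha>) = vcompsq D \<gamma>' \<phi>" by (simp add: dslice_sqr_def)

lemma ver_iff: "(u, \<gamma>) \<in> dslice_ver D I \<longleftrightarrow> (\<exists>A f B g. f \<in> hhoms D I A \<and> g \<in> hhoms D I B \<and> u \<in> vhoms D A B \<and> \<gamma> \<in> squares D f g (vid D I) u)"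
  by (auto simp: dslice_ver_def dslice_obj_def dest: hhomsD)

lemma vhomsE: "u \<in> vhoms D A B \<Longrightarrow> vdom D u = A \<and> vcod D u = B" by (simp add: vhoms_def)
lemma sqE: "s \<in> squares D a b u v \<Longrightarrow> sqtop D s = a \<and> sqbot D s = b" by (simp add: squares_def)

lemma ssq_h:
  assumes "((A, f), (A', f'), a, p) \<in> dslice_hor D I" "((A', f'), (A'', f''), a', p') \<in> dslice_hor D I"
   "((B, g), (B', g'), b, q) \<in> dslice_hor D I" "((B', g'), (B'', g''), b', q') \<in> dslice_hor D I"
   "\<alpha> \<in> squares D a b u u'" "\<alpha>' \<in> squares D a' b' u' u''"
   "\<gamma> \<in> squares D f g (vid D I) u" "\<gamma>' \<in> squares D f' g' (vid D I) u'" "\<gamma>'' \<in> squares D f'' g'' (vid D I) u''"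
   and e: "vcompsq D p (hcompsq D \<gamma> \<alpha>) = vcompsq D \<gamma>' q" and e': "vcompsq D p' (hcompsq D \<gamma>' \<alpha>') = vcompsq D \<gamma>'' q'"
  shows "vcompsq D (vcompsq D p' (hcompsq D p (vidsq D a'))) (hcompsq D \<gamma> (hcompsq D \<alpha> \<alpha>'))
   = vcompsq D \<gamma>'' (vcompsq D q' (hcompsq D q (vidsq D b')))"
proof -
  have 1: "f \<in> hhoms D I A" "f' \<in> hhoms D I A'" "f'' \<in> hhoms D I A''" "g \<in> hhoms D I B" "g' \<in> hhoms D I B'" "g'' \<in> hhoms D I B''"
     "a \<in> hhoms D A A'" "a' \<in> hhoms D A' A''" "b \<in> hhoms D B B'" "b' \<in> hhoms D B' B''"
     and p: "p \<in> squares D f' (hcomp D f a) (vid D I) (vid D A')" "p' \<in> squares D f'' (hcomp D f' a') (vid D I) (vid D A'')"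
     and q: "q \<in> squares D g' (hcomp D g b) (vid D I) (vid D B')" "q' \<in> squares D g'' (hcomp D g' b') (vid D I) (vid D B'')"
    using assms unfolding smor_iff by auto
  note a' = vidsq_in[OF 1(8)] and b' = vidsq_in[OF 1(10)]
  note ga = hsq_in[OF assms(7,5)]
  note ga' = hsq_in[OF assms(8,6)]
  have pa: "hcompsq D p (vidsq D a') \<in> squares D (hcomp D f' a') (hcomp D f (hcomp D a a')) (vid D I) (vid D A'')"
    using hsq_in[OF p(1) a'] cassoc[OF 1(1,7,8)] by simp
  note gaa = hsq_in[OF assms(7) hsq_in[OF assms(5,6)]]
  have "vcompsq D (hcompsq D p (vidsq D a')) (hcompsq D \<gamma> (hcompsq D \<alpha> \<alpha>')) = vcompsq D (hcompsq D p (vidsq D a')) (hcompsq D (hcompsq D \<gamma> \<alpha>) \<alpha>')"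
    using hassoc[OF assms(7,5,6)] by simp
  also have "\<dots> = hcompsq D (vcompsq D p (hcompsq D \<gamma> \<alpha>)) (vcompsq D (vidsq D a') \<alpha>')"
    by (rule inter[OF p(1) a' ga assms(6)])
  also have "\<dots> = hcompsq D (vcompsq D \<gamma>' q) (vcompsq D \<alpha>' (vidsq D b'))" using e vidl[OF assms(6)] vidr[OF assms(6)] by simp
  also have "\<dots> = vcompsq D (hcompsq D \<gamma>' \<alpha>') (hcompsq D q (vidsq D b'))"
    by (rule inter[OF assms(8,6) q(1) b', symmetric])
  finally have X: "vcompsq D (hcompsq D p (vidsq D a')) (hcompsq D \<gamma> (hcompsq D \<alpha> \<alpha>')) = vcompsq D (hcompsq D \<gamma>' \<alpha>') (hcompsq D q (vidsq D b'))" .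
  show ?thesis
    using vassoc[OF p(2) pa gaa] X vassoc[OF p(2) ga' hsq_in[OF q(1) b']] e' vassoc[OF assms(9) q(2) hsq_in[OF q(1) b']] by simp
qed

lemma ssq_v:
  assumes "((A, f), (A', f'), a, p) \<in> dslice_hor D I" "((B, g), (B', g'), b, q) \<in> dslice_hor D I" "((E, h), (E', h'), c, r) \<in> dslice_hor D I" 
   "\<alpha> \<in> squares D a b u u'" "\<alpha>' \<in> squares D b c v v'"
   "\<gamma> \<in> squares D f g (vid D I) u" "\<gamma>' \<in> squares D f' g' (vid D I) u'" 
   "\<delta> \<in> squares D g h (vid D I) v" "\<delta>' \<in> squares D g' h' (vid D I) v'" 
   and e: "vcompsq D p (hcompsq D \<gamma> \<alpha>) = vcompsq D \<gamma>' q" and e': "vcompsq D q (hcompsq D \<delta> \<alpha>') = vcompsq D \<delta>' r"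
  shows "vcompsq D p (hcompsq D (vcompsq D \<gamma> \<delta>) (vcompsq D \<alpha> \<alpha>')) = vcompsq D (vcompsq D \<gamma>' \<delta>') r"
proof -
  have p: "p \<in> squares D f' (hcomp D f a) (vid D I) (vid D A')" "q \<in> squares D g' (hcomp D g b) (vid D I) (vid D B')" "r \<in> squares D h' (hcomp D h c) (vid D I) (vid D E')"
    using assms unfolding smor_iff by auto
  note ga = hsq_in[OF assms(6,4)] and da = hsq_in[OF assms(8,5)]
  show ?thesis
   using inter[OF assms(6,4,8,5)] vassoc[OF p(1) ga da] vassoc[OF assms(7) p(2) da] vassoc[OF assms(7,9) p(3)] e e' by simp
qed

lemmas dslice_defs = double_pseudo_slice_def dslice_hcomp_def dslice_hid_def dslice_vcomp_def dslice_vid_def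
lemma verI: "\<gamma> \<in> squares D f g (vid D I) u \<Longrightarrow> f \<in> hhoms D I A \<Longrightarrow> g \<in> hhoms D I B \<Longrightarrow> u \<in> vhoms D A B \<Longrightarrow> (u,\<gamma>) \<in> dslice_ver D I"
  unfolding ver_iff by blast
lemma verD: "(u,\<gamma>) \<in> dslice_ver D I \<Longrightarrow> sqtop D \<gamma> \<in> hhoms D I (vdom D u) \<and> sqbot D \<gamma> \<in> hhoms D I (vcod D u) \<and> u \<in> vhoms D (vdom D u) (vcod D u) \<and> \<gamma> \<in> squares D (sqtop D \<gamma>) (sqbot D \<gamma>) (vid D I) u"
  unfolding ver_iff by (auto simp: vhoms_def squares_def)
lemma objD: "(A,f) \<in> dslice_obj D I \<longleftrightarrow> f \<in> hhoms D I A" by (auto simp: dslice_obj_def dest: hhomsD)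
lemma idE: "f \<in> hhoms D I A \<Longrightarrow> vdom D (vid D A) = A \<and> vcod D (vid D A) = A \<and> sqtop D (vidsq D f) = f \<and> sqbot D (vidsq D f) = f
   \<and> vdom D (vid D I) = I \<and> vcod D (vid D I) = I"
  using vidsq_in[of f I A] vid_in[of A] vid_in[of I] hhomsD[of f I A] by (auto simp: vhoms_def squares_def)
lemma vcE: "u \<in> vhoms D A B \<Longrightarrow> v \<in> vhoms D B E \<Longrightarrow> vdom D (vcomp D u v) = A \<and> vcod D (vcomp D u v) = E"
  using vcomp_in[of u A B v E] by (auto simp: vhoms_def)
lemma scE: "s \<in> squares D a b u v \<Longrightarrow> t \<in> squares D b c u' v' \<Longrightarrow> sqtop D (vcompsq D s t) = a \<and> sqbot D (vcompsq D s t) = c"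
  using vsq_in[of s a b u v t c u' v'] by (auto simp: squares_def)

lemma verC: assumes "(u,\<gamma>) \<in> dslice_ver D I" "(v,\<delta>) \<in> dslice_ver D I" "vcod D u = vdom D v" "sqbot D \<gamma> = sqtop D \<delta>" 
  shows "(vcomp D u v, vcompsq D \<gamma> \<delta>) \<in> dslice_ver D I" "vdom D (vcomp D u v) = vdom D u" "vcod D (vcomp D u v) = vcod D v"
     "sqtop D (vcompsq D \<gamma> \<delta>) = sqtop D \<gamma>" "sqbot D (vcompsq D \<gamma> \<delta>) = sqbot D \<delta>"
proof -
  note 1 = verD[OF assms(1)] and 2 = verD[OF assms(2)]
  have I: "I \<in> Obj D" using 1 hhomsD by blast
  have v: "v \<in> vhoms D (vcod D u) (vcod D v)" and d: "\<delta> \<in> squares D (sqbot D \<gamma>) (sqbot D \<delta>) (vid D I) v" using 2 assms by auto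
  have g: "\<gamma> \<in> squares D (sqtop D \<gamma>) (sqbot D \<gamma>) (vid D I) u" and u: "u \<in> vhoms D (vdom D u) (vcod D u)" using 1 by auto
  have gd: "vcompsq D \<gamma> \<delta> \<in> squares D (sqtop D \<gamma>) (sqbot D \<delta>) (vid D I) (vcomp D u v)" using vsq_in[OF g d] vidvid[OF I] by simp
  show "(vcomp D u v, vcompsq D \<gamma> \<delta>) \<in> dslice_ver D I" by (rule verI[OF gd _ _ vcomp_in[OF u v]]) (use 1 2 in auto)
  show "vdom D (vcomp D u v) = vdom D u" "vcod D (vcomp D u v) = vcod D v" using vcE[OF u v] by auto
  show "sqtop D (vcompsq D \<gamma> \<delta>) = sqtop D \<gamma>" "sqbot D (vcompsq D \<gamma> \<delta>) = sqbot D \<delta>" using scE[OF g d] by auto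
qed

lemma vidver: "f \<in> hhoms D I A \<Longrightarrow> (vid D A, vidsq D f) \<in> dslice_ver D I"
  by (rule verI[OF vidsq_in _ _ vid_in]) (auto dest: hhomsD)

lemma C1: assumes I: "I \<in> Obj D" 
  shows "category_on (Obj (double_pseudo_slice D I)) (Hor (double_pseudo_slice D I)) (hdom (double_pseudo_slice D I)) (hcod (double_pseudo_slice D I)) (hid (double_pseudo_slice D I)) (hcomp (double_pseudo_slice D I))"
  apply unfold_locales
  apply (auto simp: dslice_defs smor_comp smor_id smor_idl smor_idl' smor_idr smor_assoc)
  apply (auto simp: smor_iff objD intro: cunl cunr cassoc hid_in inv_id)
  apply (auto simp: cunr vidsq_in dest: hhomsD intro: hid_in)
  done

lemma C2: assumes I: "I \<in> Obj D" 
  shows "category_on (Obj (double_pseudo_slice D I)) (Ver (double_pseudo_slice D I)) (vdom (double_pseudo_slice D I)) (vcod (double_pseudo_slice D I)) (vid (double_pseudo_slice D I)) (vcomp (double_pseudo_slice D I))"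
  apply unfold_locales
  apply (auto simp: dslice_defs verC objD idE vidver dest: hhomsD)
  apply (auto dest!: verD simp: vunl vunr vidl vidr intro: vass vassoc)
  done

lemma ssqD: "(((A, f), (A', f'), a, \<psi>), ((B, g), (B', g'), b, \<phi>), (u, \<gamma>), (u', \<gamma>'), \<alpha>) \<in> dslice_sqr D I \<Longrightarrow>
  (u, \<gamma>) \<in> dslice_ver D I \<and> (u', \<gamma>') \<in> dslice_ver D I \<and> vdom D u = A \<and> vcod D u = B \<and> vdom D u' = A' \<and> vcod D u' = B'
  \<and> sqtop D \<gamma> = f \<and> sqbot D \<gamma> = g \<and> sqtop D \<gamma>' = f' \<and> sqbot D \<gamma>' = g'"
  unfolding ssq_iff smor_iff by (auto intro: verI dest: vhomsE sqE)

lemma vunit: assumes "\<gamma> \<in> squares D f g (vid D I) u" "u \<in> vhoms D A B" "f \<in> hhoms D I A" "g \<in> hhoms D I B"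
  shows "vcompsq D (vidsq D f) (hcompsq D \<gamma> (hidsq D u)) = vcompsq D \<gamma> (vidsq D g)"
  using hidr'[OF assms(1)] vidl[OF assms(1)] vidr[OF assms(1)] by simp

lemma hidS: "(u,\<gamma>) \<in> dslice_ver D I \<Longrightarrow> (((vdom D u, sqtop D \<gamma>),(vdom D u, sqtop D \<gamma>), hid D (vdom D u), vidsq D (sqtop D \<gamma>)),
   ((vcod D u, sqbot D \<gamma>),(vcod D u, sqbot D \<gamma>), hid D (vcod D u), vidsq D (sqbot D \<gamma>)), (u,\<gamma>),(u,\<gamma>),hidsq D u) \<in> dslice_sqr D I"
  unfolding ssq_iff by (auto dest!: verD intro!: smor_id vunit hidsq_in dest: hhomsD)

lemma hS: assumes "(((A, f), (A', f'), a, p), ((B, g), (B', g'), b, q), (u, \<gamma>), (u', \<gamma>'), \<alpha>) \<in> dslice_sqr D I"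
  "(((A', f'), (A'', f''), a', p'), ((B', g'), (B'', g''), b', q'), (u', \<gamma>'), (u'', \<gamma>''), \<alpha>') \<in> dslice_sqr D I"
  shows "(((A, f), (A'', f''), hcomp D a a', vcompsq D p' (hcompsq D p (vidsq D a'))),
    ((B, g), (B'', g''), hcomp D b b', vcompsq D q' (hcompsq D q (vidsq D b'))), (u, \<gamma>), (u'', \<gamma>''), hcompsq D \<alpha> \<alpha>') \<in> dslice_sqr D I"
  using assms unfolding ssq_iff by (auto intro!: smor_comp hsq_in) (auto intro!: ssq_h)

lemma vS: assumes "(((A, f), (A', f'), a, p), ((B, g), (B', g'), b, q), (u, \<gamma>), (u', \<gamma>'), \<alpha>) \<in> dslice_sqr D I"
  "(((B, g), (B', g'), b, q), ((E, h), (E', h'), c, r), (v, \<delta>), (v', \<delta>'), \<alpha>') \<in> dslice_sqr D I"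
  shows "(((A, f), (A', f'), a, p), ((E, h), (E', h'), c, r), (vcomp D u v, vcompsq D \<gamma> \<delta>), (vcomp D u' v', vcompsq D \<gamma>' \<delta>'), vcompsq D \<alpha> \<alpha>') \<in> dslice_sqr D I"
proof -
  have "f \<in> hhoms D I A" using assms unfolding ssq_iff smor_iff by auto
  hence "I \<in> Obj D" using hhomsD by blast
  hence vI: "vcomp D (vid D I) (vid D I) = vid D I" by (rule vidvid)
  have *: "vcompsq D s t \<in> squares D a c (vid D I) (vcomp D v1 v2)"
    if "s \<in> squares D a b (vid D I) v1" "t \<in> squares D b c (vid D I) v2" for s t a b c v1 v2
    using vsq_in[OF that(1,2)] vI by simp
  show ?thesis
  using assms unfolding ssq_iff by (auto intro!: vcomp_in intro: vsq_in * ) (auto intro: ssq_v)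
qed

lemma vidS: "((A, f), (A', f'), a, p) \<in> dslice_hor D I \<Longrightarrow>
   (((A, f), (A', f'), a, p), ((A, f), (A', f'), a, p), (vid D A, vidsq D f), (vid D A', vidsq D f'), vidsq D a) \<in> dslice_sqr D I"
  unfolding ssq_iff by (auto simp: smor_idl smor_idl') (auto simp: smor_iff intro: vid_in vidsq_in dest: hhomsD)

lemma hS': assumes "(((A, f), (A', f'), a, p), ((B, g), (B', g'), b, q), (u, \<gamma>), (u', \<gamma>'), \<alpha>) \<in> dslice_sqr D I"
  "(((A1, f1), (A'', f''), a', p'), ((B1, g1), (B'', g''), b', q'), (u', \<gamma>'), (u'', \<gamma>''), \<alpha>') \<in> dslice_sqr D I"
  shows "(((A, f), (A'', f''), hcomp D a a', vcompsq D p' (hcompsq D p (vidsq D a'))),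
    ((B, g), (B'', g''), hcomp D b b', vcompsq D q' (hcompsq D q (vidsq D b'))), (u, \<gamma>), (u'', \<gamma>''), hcompsq D \<alpha> \<alpha>') \<in> dslice_sqr D I"
proof -
  have e: "A1 = A'" "f1 = f'" "B1 = B'" "g1 = g'" using ssqD[OF assms(1)] ssqD[OF assms(2)] by auto
  show ?thesis using hS[OF assms(1) assms(2)[unfolded e]] .
qed

lemma ssqD': "(((A, f), (A', f'), a, \<psi>), ((B, g), (B', g'), b, \<phi>), (u, \<gamma>), (u', \<gamma>'), \<alpha>) \<in> dslice_sqr D I \<Longrightarrow>
  vdom D u = A \<and> vcod D u = B \<and> vdom D u' = A' \<and> vcod D u' = B'
  \<and> sqtop D \<gamma> = f \<and> sqbot D \<gamma> = g \<and> sqtop D \<gamma>' = f' \<and> sqbot D \<gamma>' = g' \<and>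
   ((A, f), (A', f'), a, \<psi>) \<in> dslice_hor D I \<and> ((B, g), (B', g'), b, \<phi>) \<in> dslice_hor D I \<and>
       u \<in> vhoms D A B \<and> \<gamma> \<in> squares D f g (vid D I) u \<and>
       u' \<in> vhoms D A' B' \<and> \<gamma>' \<in> squares D f' g' (vid D I) u' \<and>
       \<alpha> \<in> squares D a b u u' \<and> f \<in> hhoms D I A \<and> f' \<in> hhoms D I A' \<and> a \<in> hhoms D A A' \<and> \<psi> \<in> squares D f' (hcomp D f a) (vid D I) (vid D A')
   \<and>  g \<in> hhoms D I B \<and> g' \<in> hhoms D I B' \<and> b \<in> hhoms D B B' \<and> \<phi> \<in> squares D g' (hcomp D g b) (vid D I) (vid D B')"
  using ssqD unfolding ssq_iff smor_iff by (auto dest: vhomsE sqE)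

lemma hdefs: "(x,y,a,p) \<in> dslice_hor D I \<Longrightarrow> fst x \<in> Obj D \<and> fst y \<in> Obj D \<and> snd x \<in> hhoms D I (fst x) \<and> snd y \<in> hhoms D I (fst y) \<and> a \<in> hhoms D (fst x) (fst y)"
   by (cases x; cases y) (auto simp: smor_iff dest: hhomsD)

lemma C3: assumes I: "I \<in> Obj D" shows "category_on (Ver (double_pseudo_slice D I)) (Sqr (double_pseudo_slice D I)) (sqleft (double_pseudo_slice D I)) (sqright (double_pseudo_slice D I)) (hidsq (double_pseudo_slice D I)) (hcompsq (double_pseudo_slice D I))"
  apply unfold_locales
  apply (auto simp: dslice_defs hidS hS' dest: ssqD)
  apply (auto dest!: ssqD' simp: smor_idl smor_idl' smor_idr smor_assoc)
  apply (auto simp: cunl cunr hidl' hidr' smor_idl smor_idl' smor_idr smor_assoc intro: cassoc hassoc)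
  done

lemma C4: assumes I: "I \<in> Obj D" shows "category_on (Hor (double_pseudo_slice D I)) (Sqr (double_pseudo_slice D I)) (sqtop (double_pseudo_slice D I)) (sqbot (double_pseudo_slice D I)) (vidsq (double_pseudo_slice D I)) (vcompsq (double_pseudo_slice D I))"
  apply unfold_locales
  apply (auto simp: dslice_defs vidS vS dest: ssq_iff[THEN iffD1])
  apply (auto dest!: ssqD' simp: vunl vunr vidl vidr intro: vass vassoc)
  done

lemma double_category_double_pseudo_slice: assumes I: "I \<in> Obj D" shows "double_category (double_pseudo_slice D I)"
  apply (intro double_category.intro C1 C2 C3 C4 I)
  apply unfold_locales
  apply (auto simp: dslice_defs verC)
  apply (auto dest!: ssqD' verD simp: objD idE)
  apply (auto dest: sqE vhomsE simp: smor_iff hidsq_vid idE hidc idc inter dest: hhomsD intro: inter hidc idc)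
  done

lemma double_functor_double_slice_proj: assumes I: "I \<in> Obj D" shows "double_functor (double_pseudo_slice D I) D double_slice_proj"
proof -
  interpret P: double_category "double_pseudo_slice D I" by (rule double_category_double_pseudo_slice[OF I])
  show ?thesis
  apply unfold_locales
  apply (auto simp: dslice_defs double_slice_proj_def)
  apply (auto simp: hhoms_def vhoms_def squares_def objD)
  apply (auto dest!: ssqD' hdefs verD)
  apply (auto simp: hhoms_def vhoms_def squares_def hid_in intro: hor.dom_in hor.cod_in)
  done
qed

abbreviation hor_cells :: "'s set" where
  "hor_cells \<equiv> {s \<in> Sqr D. sqleft D s = vid D (hdom D (sqtop D s)) \<and> sqright D s = vid D (hcod D (sqtop D s))}"

lemma CCI: "s \<in> squares D f g (vid D A) (vid D B) \<Longrightarrow> f \<in> hhoms D A B \<Longrightarrow> s \<in> hor_cells \<and> sqtop D s = f \<and> sqbot D s = g \<and> hdom D (sqtop D s) = A \<and> hcod D (sqtop D s) = B"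
  by (auto simp: squares_def hhoms_def)
lemma CCD: assumes "s \<in> hor_cells" shows "\<exists>f g A B. s \<in> squares D f g (vid D A) (vid D B) \<and> f \<in> hhoms D A B \<and> g \<in> hhoms D A B \<and> A \<in> Obj D \<and> B \<in> Obj D
   \<and> sqtop D s = f \<and> sqbot D s = g \<and> hdom D (sqtop D s) = A \<and> hcod D (sqtop D s) = B"
proof -
  have "sqtop D s \<in> hhoms D (hdom D (sqtop D s)) (hcod D (sqtop D s))" "s \<in> squares D (sqtop D s) (sqbot D s) (vid D (hdom D (sqtop D s))) (vid D (hcod D (sqtop D s)))"
    using assms by (auto simp: hhoms_def squares_def vsq.dom_in)
  thus ?thesis using sq_hom hhomsD by blast
qed
lemma hC1: "category_on (Hor D) hor_cells (sqtop D) (sqbot D) (vidsq D) (vcompsq D)"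
proof (unfold_locales, goal_cases)
  case (3 A) thus ?case by (auto simp: vsq.ide_in vsq.dom_ide sqleft_vidsq sqright_vidsq)
next case (6 f g)
  obtain a b A B where f: "f \<in> squares D a b (vid D A) (vid D B)" "a \<in> hhoms D A B" "b \<in> hhoms D A B" "A \<in> Obj D" "B \<in> Obj D" "sqtop D f = a" "sqbot D f = b" using CCD[OF 6(1)] by blast
  obtain a' c A' B' where g: "g \<in> squares D a' c (vid D A') (vid D B')" "a' \<in> hhoms D A' B'" "sqtop D g = a'" using CCD[OF 6(2)] by blast
  have e: "a' = b" "A' = A" "B' = B" using f g 6 by (auto simp: hhoms_def)
  show ?case using CCI[of "vcompsq D f g" a c A B] vsq_in[OF f(1) g(1)[unfolded e]] f vidvid by auto
qed (auto simp: vsq.dom_in vsq.cod_in vsq.ide_in vsq.dom_ide vsq.cod_ide vsq.dom_cmp vsq.cod_cmp vsq.cmp_assoc vsq.ide_cmp vsq.cmp_ide)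

lemma CCh: assumes "f \<in> hor_cells" "g \<in> hor_cells" "hcod D (sqtop D f) = hdom D (sqtop D g)"
  shows "hcompsq D f g \<in> hor_cells" "hdom D (sqtop D (hcompsq D f g)) = hdom D (sqtop D f)" "hcod D (sqtop D (hcompsq D f g)) = hcod D (sqtop D g)"
proof -
  obtain a b A B where f: "f \<in> squares D a b (vid D A) (vid D B)" "a \<in> hhoms D A B" "sqtop D f = a" "hdom D (sqtop D f) = A" "hcod D (sqtop D f) = B" using CCD[OF assms(1)] by blast
  obtain a' b' E where g: "g \<in> squares D a' b' (vid D B) (vid D E)" "a' \<in> hhoms D B E" "sqtop D g = a'" "hcod D (sqtop D g) = E" using CCD[OF assms(2)] assms(3) f by auto
  note X = CCI[OF hsq_in[OF f(1) g(1)] hcomp_in[OF f(2) g(2)]]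
  show "hcompsq D f g \<in> hor_cells" "hdom D (sqtop D (hcompsq D f g)) = hdom D (sqtop D f)" "hcod D (sqtop D (hcompsq D f g)) = hcod D (sqtop D g)"
    using X f g by auto
qed
lemma CCid: "A \<in> Obj D \<Longrightarrow> vidsq D (hid D A) \<in> hor_cells \<and> hdom D (sqtop D (vidsq D (hid D A))) = A \<and> hcod D (sqtop D (vidsq D (hid D A))) = A"
  using CCI[OF vidsq_in[OF hid_in] hid_in] by (auto simp: hor.dom_ide hor.cod_ide)

lemma hC2: "category_on (Obj D) hor_cells (\<lambda>c. hdom D (sqtop D c)) (\<lambda>c. hcod D (sqtop D c)) (\<lambda>A. vidsq D (hid D A)) (hcompsq D)"
proof (unfold_locales, goal_cases)
  case (1 f) thus ?case by (auto simp: hor.dom_in vsq.dom_in)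
next case (2 f) thus ?case by (auto simp: hor.cod_in vsq.dom_in)
next case (3 A) thus ?case using CCid by blast
next case (4 A) thus ?case using CCid by blast
next case (5 A) thus ?case using CCid by blast
next case (6 f g) thus ?case using CCh by blast
next case (7 f g) thus ?case using CCh by blast
next case (8 f g) thus ?case using CCh by blast
next case (9 f) from CCD[OF this] show ?case by (auto simp: hidl)
next case (10 f) from CCD[OF this] show ?case by (auto simp: hidr)
next case (11 f g h) thus ?case by (auto simp: hsq.cmp_assoc)
qed

lemma two_category_hor_twocat: "two_category (hor_twocat D)"
proof (intro two_category.intro two_category_axioms.intro, goal_cases)
  case 1 show ?case by (simp add: hor_twocat_def hor.category_on_axioms)
next case 2 show ?case using hC1 by (simp add: hor_twocat_def)
next case 3 show ?case using hC2 by (simp add: hor_twocat_def)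
next case (4 c) hence "c \<in> hor_cells" by (simp add: hor_twocat_def)
  from CCD[OF this] show ?case by (auto simp: hor_twocat_def hhoms_def)
next case (5 c) hence "c \<in> hor_cells" by (simp add: hor_twocat_def)
  from CCD[OF this] show ?case by (auto simp: hor_twocat_def hhoms_def)
qed (auto simp: hor_twocat_def sqtop_hcompsq sqbot_hcompsq vidsq_hcomp intro: interchange)
end

end

theory Submission
  imports Defs
begin

text \<open>
  Both projections from the pseudo-slices are (double) functors, and a cell of a pseudo-slice is a
  cell of the base together with its boundary. Hence full faithfulness on cells says only that every
  cell of the base satisfies the compatibility equation of the pseudo-slice; uniqueness is automatic.
  Moreover, the pseudo-slices of \<open>D\<close> and of \<open>hor_twocat D\<close> have the same objects and the same
  horizontal morphisms. So the two notions differ in two points: a double bi-initial object also needs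
  a square \<open>\<gamma>\<close> from the identity at \<open>I\<close> to every vertical morphism \<open>u\<close>, and the compatibility
  equation for squares with arbitrary left and right boundaries.

  From double bi-initial to bi-initial, the equation for 2-cells is the one for squares between
  vertical identities, taken with \<open>\<gamma>\<close> and \<open>\<gamma>'\<close> vertical identity squares.

  Conversely, tabulators turn vertical morphisms into objects, where bi-initiality applies. A morphism
  from \<open>I\<close> to the tabulator \<open>T\<close> of \<open>u\<close>, followed by the square \<open>\<tau>\<close> of the tabulator, is a square
  to \<open>u\<close>. For a square \<open>\<alpha>\<close> from \<open>u\<close> to \<open>u'\<close>, let \<open>s: T \<rightarrow> T'\<close> be the morphism that it induces on
  tabulators, and let \<open>t\<close> and \<open>t'\<close> correspond to \<open>\<gamma>\<close> and \<open>\<gamma>'\<close>. Bi-initiality gives an invertible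
  \<open>\<chi>: t' \<Rightarrow> t s\<close>. Composing \<open>\<chi>\<close> with the two projections of \<open>T'\<close> gives invertible cells with the
  boundaries of \<open>\<psi>\<close> and \<open>\<phi>\<close>, and since comparison cells out of a bi-initial object are unique, they
  are \<open>\<psi>\<close> and \<open>\<phi>\<close>. The equation for \<open>\<alpha>\<close> is then the interchange law for \<open>\<chi>\<close> and the square of
  the tabulator \<open>T'\<close>.
\<close>

section \<open>Bi-initiality without fibrations\<close>

lemma (in two_category) bi_initial_iff:
  assumes I: "I \<in> Ob C"
  shows "bi_initial C I \<longleftrightarrow>
    (\<forall>A \<in> Ob C. homs C I A \<noteq> {}) \<and>
    (\<forall>A A'. \<forall>f \<in> homs C I A. \<forall>f' \<in> homs C I A'. \<forall>a \<in> homs C A A'.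
       \<exists>\<psi>. ((A, f), (A', f'), a, \<psi>) \<in> slice_mor C I) \<and>
    (\<forall>A A' f f' a b \<psi> \<phi>. ((A, f), (A', f'), a, \<psi>) \<in> slice_mor C I \<longrightarrow>
       ((A, f), (A', f'), b, \<phi>) \<in> slice_mor C I \<longrightarrow>
       (\<forall>\<beta> \<in> cells C a b. vcomp2 C \<psi> (hcomp2 C (id2 C f) \<beta>) = \<phi>))"
    (is "_ \<longleftrightarrow> ?O \<and> ?M \<and> ?C")
proof -
  let ?S = "pseudo_slice C I"
  have O: "(\<forall>B \<in> Ob C. \<exists>x \<in> Ob ?S. onOb slice_proj x = B) \<longleftrightarrow> ?O"
    by (auto simp: pseudo_slice_def slice_proj_def slice_ob_def)
  have homs: "m \<in> homs ?S x y \<longleftrightarrow> (\<exists>a \<psi>. m = (x, y, a, \<psi>) \<and> (x, y, a, \<psi>) \<in> slice_mor C I)" for m x y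
    by (cases m) (auto simp: homs_def pseudo_slice_def)
  have obs: "(A, f) \<in> Ob ?S \<longleftrightarrow> f \<in> homs C I A" for A f
    by (auto simp: pseudo_slice_def slice_ob_def dest: homsD)
  have M: "(\<forall>x \<in> Ob ?S. \<forall>y \<in> Ob ?S. \<forall>b \<in> homs C (onOb slice_proj x) (onOb slice_proj y).
        \<exists>m \<in> homs ?S x y. onMor slice_proj m = b) \<longleftrightarrow> ?M"
    by (simp add: homs Bex_def slice_proj_def split_paired_all Ball_def obs) blast
  have cell: "(\<exists>!c. c \<in> cells ?S (x, y, a, \<psi>) (x, y, b, \<phi>) \<and> onCell slice_proj c = \<beta>) \<longleftrightarrow>
      vcomp2 C \<psi> (hcomp2 C (id2 C (snd x)) \<beta>) = \<phi>"
    if "(x, y, a, \<psi>) \<in> slice_mor C I" "(x, y, b, \<phi>) \<in> slice_mor C I" "\<beta> \<in> cells C a b"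
    for x y a b \<psi> \<phi> \<beta>
    using that by (cases x; cases y) (auto simp: cells_def pseudo_slice_def slice_proj_def slice_cell_def)
  have mob: "x \<in> Ob ?S" "y \<in> Ob ?S" if "(x, y, a, \<psi>) \<in> slice_mor C I" for x y a \<psi>
    using that by (auto simp: pseudo_slice_def slice_mor_def)
  have C: "(\<forall>x \<in> Ob ?S. \<forall>y \<in> Ob ?S. \<forall>m \<in> homs ?S x y. \<forall>n \<in> homs ?S x y.
        \<forall>\<beta> \<in> cells C (onMor slice_proj m) (onMor slice_proj n).
          \<exists>!c. c \<in> cells ?S m n \<and> onCell slice_proj c = \<beta>) \<longleftrightarrow> ?C" (is "?L \<longleftrightarrow> _")
  proof
    assume L: ?L
    show ?C
    proof (intro allI impI ballI)
      fix A A' f f' a b \<psi> \<phi> \<beta>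
      assume m: "((A, f), (A', f'), a, \<psi>) \<in> slice_mor C I"
        and n: "((A, f), (A', f'), b, \<phi>) \<in> slice_mor C I" and \<beta>: "\<beta> \<in> cells C a b"
      have "\<exists>!c. c \<in> cells ?S ((A, f), (A', f'), a, \<psi>) ((A, f), (A', f'), b, \<phi>) \<and>
          onCell slice_proj c = \<beta>"
        by (rule L[rule_format, of "(A, f)" "(A', f')"])
          (use m n \<beta> mob[OF m] in \<open>auto simp: homs slice_proj_def\<close>)
      then show "vcomp2 C \<psi> (hcomp2 C (id2 C f) \<beta>) = \<phi>"
        using cell[OF m n \<beta>] by simp
    qed
  next
    assume R: ?C
    show ?L
    proof (intro ballI)
      fix x y m n \<beta>
      assume "m \<in> homs ?S x y" "n \<in> homs ?S x y"
        and "\<beta> \<in> cells C (onMor slice_proj m) (onMor slice_proj n)"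
      then obtain a \<psi> b \<phi> where e: "m = (x, y, a, \<psi>)" "n = (x, y, b, \<phi>)"
        and m: "(x, y, a, \<psi>) \<in> slice_mor C I" and n: "(x, y, b, \<phi>) \<in> slice_mor C I"
        and \<beta>: "\<beta> \<in> cells C a b"
        by (auto simp: homs slice_proj_def)
      have "vcomp2 C \<psi> (hcomp2 C (id2 C (snd x)) \<beta>) = \<phi>"
        by (rule R[rule_format, of "fst x" "snd x" "fst y" "snd y" a \<psi> b \<phi>]) (use m n \<beta> in auto)
      then show "\<exists>!c. c \<in> cells ?S m n \<and> onCell slice_proj c = \<beta>"
        unfolding e using cell[OF m n \<beta>] by simp
    qed
  qed
  show ?thesis
    unfolding bi_initial_def trivial_fibration_def O M C
    using I two_functor_slice_proj[OF I] by simp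
qed

context double_category begin

lemma double_bi_initial_iff:
  assumes I: "I \<in> Obj D"
  shows "double_bi_initial D I \<longleftrightarrow>
    (\<forall>A \<in> Obj D. hhoms D I A \<noteq> {}) \<and>
    (\<forall>A A'. \<forall>f \<in> hhoms D I A. \<forall>f' \<in> hhoms D I A'. \<forall>a \<in> hhoms D A A'.
       \<exists>\<psi>. ((A, f), (A', f'), a, \<psi>) \<in> dslice_hor D I) \<and>
    (\<forall>u \<in> Ver D. \<exists>\<gamma>. (u, \<gamma>) \<in> dslice_ver D I) \<and>
    (\<forall>A A' B B' f f' g g' a b \<psi> \<phi> u u' \<gamma> \<gamma>'.
       ((A, f), (A', f'), a, \<psi>) \<in> dslice_hor D I \<longrightarrow> ((B, g), (B', g'), b, \<phi>) \<in> dslice_hor D I \<longrightarrow>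
       u \<in> vhoms D A B \<longrightarrow> u' \<in> vhoms D A' B' \<longrightarrow>
       \<gamma> \<in> squares D f g (vid D I) u \<longrightarrow> \<gamma>' \<in> squares D f' g' (vid D I) u' \<longrightarrow>
       (\<forall>\<alpha> \<in> squares D a b u u'. vcompsq D \<psi> (hcompsq D \<gamma> \<alpha>) = vcompsq D \<gamma>' \<phi>))"
    (is "_ \<longleftrightarrow> ?O \<and> ?H \<and> ?V \<and> ?S")
proof -
  let ?P = "double_pseudo_slice D I"
  let ?F = "double_slice_proj"
  have obs: "(A, f) \<in> Obj ?P \<longleftrightarrow> f \<in> hhoms D I A" for A f
    by (simp add: double_pseudo_slice_def objD)
  have O: "(\<forall>B \<in> Obj D. \<exists>x \<in> Obj ?P. onObj ?F x = B) \<longleftrightarrow> ?O"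
    by (auto simp: double_slice_proj_def double_pseudo_slice_def dslice_obj_def)
  have hhoms: "m \<in> hhoms ?P x y \<longleftrightarrow> (\<exists>a \<psi>. m = (x, y, a, \<psi>) \<and> (x, y, a, \<psi>) \<in> dslice_hor D I)" for m x y
    by (cases m) (auto simp: hhoms_def double_pseudo_slice_def)
  have vhoms: "(u, \<gamma>) \<in> vhoms ?P (A, f) (B, g) \<longleftrightarrow> f \<in> hhoms D I A \<and> g \<in> hhoms D I B \<and>
      u \<in> vhoms D A B \<and> \<gamma> \<in> squares D f g (vid D I) u" for u \<gamma> A f B g
  proof
    assume "(u, \<gamma>) \<in> vhoms ?P (A, f) (B, g)"
    then show "f \<in> hhoms D I A \<and> g \<in> hhoms D I B \<and> u \<in> vhoms D A B \<and> \<gamma> \<in> squares D f g (vid D I) u"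
      using verD[of u \<gamma> I] by (auto simp: vhoms_def double_pseudo_slice_def)
  next
    assume "f \<in> hhoms D I A \<and> g \<in> hhoms D I B \<and> u \<in> vhoms D A B \<and> \<gamma> \<in> squares D f g (vid D I) u"
    then show "(u, \<gamma>) \<in> vhoms ?P (A, f) (B, g)"
      using verI[of \<gamma> f g I u A B] by (auto simp: vhoms_def double_pseudo_slice_def squares_def)
  qed
  have H: "(\<forall>x \<in> Obj ?P. \<forall>y \<in> Obj ?P. \<forall>b \<in> hhoms D (onObj ?F x) (onObj ?F y).
        \<exists>m \<in> hhoms ?P x y. onHor ?F m = b) \<longleftrightarrow> ?H"
    by (simp add: hhoms Bex_def double_slice_proj_def split_paired_all Ball_def obs) blast
  have V: "(\<forall>w \<in> Ver D. \<exists>k \<in> Ver ?P. onVer ?F k = w) \<longleftrightarrow> ?V"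
    by (simp add: Bex_def double_slice_proj_def double_pseudo_slice_def)
  have squares: "s \<in> squares ?P m n k l \<longleftrightarrow> (\<exists>\<alpha>. s = (m, n, k, l, \<alpha>) \<and> (m, n, k, l, \<alpha>) \<in> dslice_sqr D I)"
    for s m n k l
    by (cases s) (auto simp: squares_def double_pseudo_slice_def)
  have sqr: "(\<exists>!s. s \<in> squares ?P ((A, f), (A', f'), a, \<psi>) ((B, g), (B', g'), b, \<phi>) (u, \<gamma>) (u', \<gamma>') \<and>
        onSqr ?F s = \<alpha>) \<longleftrightarrow> vcompsq D \<psi> (hcompsq D \<gamma> \<alpha>) = vcompsq D \<gamma>' \<phi>"
    if "((A, f), (A', f'), a, \<psi>) \<in> dslice_hor D I" "((B, g), (B', g'), b, \<phi>) \<in> dslice_hor D I"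
      "u \<in> vhoms D A B" "u' \<in> vhoms D A' B'" "\<gamma> \<in> squares D f g (vid D I) u"
      "\<gamma>' \<in> squares D f' g' (vid D I) u'" "\<alpha> \<in> squares D a b u u'"
    for A A' B B' f f' g g' a b \<psi> \<phi> u u' \<gamma> \<gamma>' \<alpha>
  proof -
    have "s \<in> squares ?P ((A, f), (A', f'), a, \<psi>) ((B, g), (B', g'), b, \<phi>) (u, \<gamma>) (u', \<gamma>') \<and>
        onSqr ?F s = \<alpha> \<longleftrightarrow>
        s = (((A, f), (A', f'), a, \<psi>), ((B, g), (B', g'), b, \<phi>), (u, \<gamma>), (u', \<gamma>'), \<alpha>) \<and>
        vcompsq D \<psi> (hcompsq D \<gamma> \<alpha>) = vcompsq D \<gamma>' \<phi>" for s
      using that by (auto simp: squares double_slice_proj_def ssq_iff)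
    then show ?thesis by auto
  qed
  have S: "(\<forall>x \<in> Obj ?P. \<forall>x' \<in> Obj ?P. \<forall>y \<in> Obj ?P. \<forall>y' \<in> Obj ?P.
      \<forall>m \<in> hhoms ?P x x'. \<forall>n \<in> hhoms ?P y y'. \<forall>k \<in> vhoms ?P x y. \<forall>l \<in> vhoms ?P x' y'.
      \<forall>\<alpha> \<in> squares D (onHor ?F m) (onHor ?F n) (onVer ?F k) (onVer ?F l).
        \<exists>!s. s \<in> squares ?P m n k l \<and> onSqr ?F s = \<alpha>) \<longleftrightarrow> ?S" (is "?L \<longleftrightarrow> _")
  proof
    assume L: ?L
    show ?S
    proof (intro allI impI ballI)
      fix A A' B B' f f' g g' a b \<psi> \<phi> u u' \<gamma> \<gamma>' \<alpha>
      assume h: "((A, f), (A', f'), a, \<psi>) \<in> dslice_hor D I" "((B, g), (B', g'), b, \<phi>) \<in> dslice_hor D I"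
        "u \<in> vhoms D A B" "u' \<in> vhoms D A' B'" "\<gamma> \<in> squares D f g (vid D I) u"
        "\<gamma>' \<in> squares D f' g' (vid D I) u'" "\<alpha> \<in> squares D a b u u'"
      have fs: "f \<in> hhoms D I A" "f' \<in> hhoms D I A'" "g \<in> hhoms D I B" "g' \<in> hhoms D I B'"
        using h(1,2) unfolding smor_iff by auto
      have "\<exists>!s. s \<in> squares ?P ((A, f), (A', f'), a, \<psi>) ((B, g), (B', g'), b, \<phi>) (u, \<gamma>) (u', \<gamma>') \<and>
        onSqr ?F s = \<alpha>"
        by (rule L[rule_format, of "(A, f)" "(A', f')" "(B, g)" "(B', g')"])
          (use h fs in \<open>simp_all add: obs hhoms vhoms double_slice_proj_def\<close>)
      then show "vcompsq D \<psi> (hcompsq D \<gamma> \<alpha>) = vcompsq D \<gamma>' \<phi>"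
        using sqr[OF h] by simp
    qed
  next
    assume R: ?S
    show ?L
    proof (intro ballI)
      fix x x' y y' m n k l \<alpha>
      assume as: "m \<in> hhoms ?P x x'" "n \<in> hhoms ?P y y'" "k \<in> vhoms ?P x y" "l \<in> vhoms ?P x' y'"
        and \<alpha>: "\<alpha> \<in> squares D (onHor ?F m) (onHor ?F n) (onVer ?F k) (onVer ?F l)"
      obtain A f A' f' B g B' g' where xy: "x = (A, f)" "x' = (A', f')" "y = (B, g)" "y' = (B', g')"
        by (meson surj_pair)
      obtain u \<gamma> u' \<gamma>' where kl: "k = (u, \<gamma>)" "l = (u', \<gamma>')" by (meson surj_pair)
      obtain a \<psi> b \<phi> where mn: "m = ((A, f), (A', f'), a, \<psi>)" "n = ((B, g), (B', g'), b, \<phi>)"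
        and h: "((A, f), (A', f'), a, \<psi>) \<in> dslice_hor D I" "((B, g), (B', g'), b, \<phi>) \<in> dslice_hor D I"
        using as(1,2) unfolding xy hhoms by auto
      have v: "u \<in> vhoms D A B" "u' \<in> vhoms D A' B'" "\<gamma> \<in> squares D f g (vid D I) u"
        "\<gamma>' \<in> squares D f' g' (vid D I) u'"
        using as(3,4) unfolding xy kl vhoms by auto
      have \<alpha>': "\<alpha> \<in> squares D a b u u'"
        using \<alpha> by (simp add: mn kl double_slice_proj_def)
      show "\<exists>!s. s \<in> squares ?P m n k l \<and> onSqr ?F s = \<alpha>"
        unfolding mn kl sqr[OF h v \<alpha>'] using R h v \<alpha>' by blast
    qed
  qed
  show ?thesis
    unfolding double_bi_initial_def double_trivial_fibration_def O H V S
    using I double_functor_double_slice_proj[OF I] by simp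
qed

section \<open>Comparing the two pseudo-slices\<close>

lemma homs_hor_twocat: "homs (hor_twocat D) A B = hhoms D A B"
  by (simp add: homs_def hhoms_def hor_twocat_def)

lemma cells_hor_twocat:
  assumes "f \<in> hhoms D A B"
  shows "cells (hor_twocat D) f g = squares D f g (vid D A) (vid D B)"
  using assms by (auto simp: cells_def squares_def hhoms_def hor_twocat_def)

text \<open>An inverse in \<open>hor_twocat D\<close> has vertical identities on its sides by definition. A vertical inverse
  in \<open>D\<close> has them because its sides compose with identities to identities.\<close>

lemma invertible2_hor_twocat:
  assumes c: "c \<in> squares D f g (vid D A) (vid D B)" and f: "f \<in> hhoms D A B"
  shows "invertible2 (hor_twocat D) c \<longleftrightarrow> vert_invertible D c"
proof -
  have sel: "src2 (hor_twocat D) c = f" "tgt2 (hor_twocat D) c = g" "c \<in> Cell (hor_twocat D)"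
    "vcomp2 (hor_twocat D) = vcompsq D" "id2 (hor_twocat D) = vidsq D"
    using c f by (auto simp: hor_twocat_def squares_def hhoms_def)
  have inv: "invertible2 (hor_twocat D) c \<longleftrightarrow>
      (\<exists>d \<in> squares D g f (vid D A) (vid D B). vcompsq D c d = vidsq D f \<and> vcompsq D d c = vidsq D g)"
    using sel by (simp add: invertible2_def cells_hor_twocat[OF sq_hom[OF c f]])
  show ?thesis
    unfolding inv using invE[OF c f] invI[OF c f] by blast
qed

lemma slice_mor_hor_twocat: "slice_mor (hor_twocat D) I = dslice_hor D I"
proof -
  interpret H: two_category "hor_twocat D" by (rule two_category_hor_twocat)
  have sel: "comp1 (hor_twocat D) = hcomp D" by (simp add: hor_twocat_def)
  have "((A, f), (A', f'), a, \<psi>) \<in> slice_mor (hor_twocat D) I \<longleftrightarrow>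
      ((A, f), (A', f'), a, \<psi>) \<in> dslice_hor D I" for A f A' f' a \<psi>
    unfolding H.smor_iff smor_iff homs_hor_twocat sel
    using cells_hor_twocat[of f' I A'] invertible2_hor_twocat[of \<psi> f' _ I A'] by auto
  then show ?thesis by auto
qed

lemma bi_initial_hor_twocat_iff:
  assumes I: "I \<in> Obj D"
  shows "bi_initial (hor_twocat D) I \<longleftrightarrow>
    (\<forall>A \<in> Obj D. hhoms D I A \<noteq> {}) \<and>
    (\<forall>A A'. \<forall>f \<in> hhoms D I A. \<forall>f' \<in> hhoms D I A'. \<forall>a \<in> hhoms D A A'.
       \<exists>\<psi>. ((A, f), (A', f'), a, \<psi>) \<in> dslice_hor D I) \<and>
    (\<forall>A A' f f' a b \<psi> \<phi>. ((A, f), (A', f'), a, \<psi>) \<in> dslice_hor D I \<longrightarrow>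
       ((A, f), (A', f'), b, \<phi>) \<in> dslice_hor D I \<longrightarrow>
       (\<forall>\<beta> \<in> squares D a b (vid D A) (vid D A'). vcompsq D \<psi> (hcompsq D (vidsq D f) \<beta>) = \<phi>))"
proof -
  interpret H: two_category "hor_twocat D" by (rule two_category_hor_twocat)
  have cells: "cells (hor_twocat D) a b = squares D a b (vid D A) (vid D A')"
    if "((A, f), (A', f'), a, \<psi>) \<in> dslice_hor D I" for A A' f f' a b \<psi>
    using that cells_hor_twocat unfolding smor_iff by blast
  have sel: "Ob (hor_twocat D) = Obj D" "vcomp2 (hor_twocat D) = vcompsq D"
    "hcomp2 (hor_twocat D) = hcompsq D" "id2 (hor_twocat D) = vidsq D"
    by (simp_all add: hor_twocat_def)
  show ?thesis
    unfolding H.bi_initial_iff[unfolded sel, OF I] slice_mor_hor_twocat homs_hor_twocat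
    by (simp add: cells cong: imp_cong)
qed

section \<open>The two directions\<close>

text \<open>A 2-cell is a square between vertical identities, and these lift to the pseudo-slice by
  \<open>\<gamma> = vidsq D f\<close> and \<open>\<gamma>' = vidsq D f'\<close>. With this choice the equation for squares becomes the one
  for 2-cells.\<close>

lemma double_bi_initial_imp_bi_initial:
  assumes I: "I \<in> Obj D" and d: "double_bi_initial D I"
  shows "bi_initial (hor_twocat D) I"
proof -
  note d' = d[unfolded double_bi_initial_iff[OF I]]
  have compat: "vcompsq D \<psi> (hcompsq D (vidsq D f) \<beta>) = \<phi>"
    if m: "((A, f), (A', f'), a, \<psi>) \<in> dslice_hor D I" and n: "((A, f), (A', f'), b, \<phi>) \<in> dslice_hor D I"
      and \<beta>: "\<beta> \<in> squares D a b (vid D A) (vid D A')" for A A' f f' a b \<psi> \<phi> \<beta>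
  proof -
    have f: "f \<in> hhoms D I A" "f' \<in> hhoms D I A'" using m unfolding smor_iff by auto
    have "vcompsq D \<psi> (hcompsq D (vidsq D f) \<beta>) = vcompsq D (vidsq D f') \<phi>"
      using d' m n \<beta> vidsq_in[OF f(1)] vidsq_in[OF f(2)]
        vid_in[of A] vid_in[of A'] hhomsD[OF f(1)] hhomsD[OF f(2)]
      by blast
    then show ?thesis using smor_idl'[OF n] by simp
  qed
  show ?thesis
    unfolding bi_initial_hor_twocat_iff[OF I]
    by (intro conjI d'[THEN conjunct1] d'[THEN conjunct2, THEN conjunct1])
      (intro allI impI ballI, rule compat)
qed

text \<open>This is full faithfulness on 2-cells, applied to the identity 2-cell at \<open>a\<close>.\<close>

lemma bi_initial_comparison_unique:
  assumes I: "I \<in> Obj D" and b: "bi_initial (hor_twocat D) I"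
    and m: "((A, f), (A', f'), a, \<psi>) \<in> dslice_hor D I" and n: "((A, f), (A', f'), a, \<phi>) \<in> dslice_hor D I"
  shows "\<psi> = \<phi>"
proof -
  have "a \<in> hhoms D A A'" using m unfolding smor_iff by auto
  then have "vcompsq D \<psi> (hcompsq D (vidsq D f) (vidsq D a)) = \<phi>"
    using b[unfolded bi_initial_hor_twocat_iff[OF I]] m n vidsq_in by blast
  then show ?thesis using smor_idl[OF m] by simp
qed

text \<open>Comparing boundaries in \<open>\<gamma> = e\<^sub>t \<tau>\<close> shows that \<open>t\<close> also factors the top and the bottom of \<open>\<gamma>\<close>
  through the two projections of the tabulator.\<close>

lemma tabulator_factor:
  assumes tab: "is_tabulator D u T \<tau>" and u: "u \<in> vhoms D A B"
    and f: "f \<in> hhoms D X A" and g: "g \<in> hhoms D X B" and \<gamma>: "\<gamma> \<in> squares D f g (vid D X) u"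
  obtains t where "t \<in> hhoms D X T" "\<gamma> = hcompsq D (vidsq D t) \<tau>"
    "hcomp D t (sqtop D \<tau>) = f" "hcomp D t (sqbot D \<tau>) = g"
proof -
  have X: "X \<in> Obj D" using hhomsD[OF f] by simp
  have AB: "vdom D u = A" "vcod D u = B" using u by (simp_all add: vhoms_def)
  have \<tau>: "\<tau> \<in> squares D (sqtop D \<tau>) (sqbot D \<tau>) (vid D T) u"
    using tab by (simp add: is_tabulator_def Let_def)
  have ex: "\<forall>X \<in> Obj D. \<forall>f \<in> hhoms D X A. \<forall>g \<in> hhoms D X B. \<forall>\<gamma> \<in> squares D f g (vid D X) u.
      \<exists>!t. t \<in> hhoms D X T \<and> \<gamma> = hcompsq D (vidsq D t) \<tau>"
    using tab by (simp add: is_tabulator_def Let_def AB)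
  obtain t where t: "t \<in> hhoms D X T" "\<gamma> = hcompsq D (vidsq D t) \<tau>"
    using ex[rule_format, OF X f g \<gamma>] by blast
  have "\<gamma> \<in> squares D (hcomp D t (sqtop D \<tau>)) (hcomp D t (sqbot D \<tau>)) (vid D X) u"
    unfolding t(2) by (rule hsq_in[OF vidsq_in[OF t(1)] \<tau>])
  then have "hcomp D t (sqtop D \<tau>) = f" "hcomp D t (sqbot D \<tau>) = g"
    using \<gamma> by (simp_all add: squares_def)
  then show thesis using that t by blast
qed

text \<open>Whiskering carries a comparison cell at the tabulators to one at the objects below them: here
  \<open>p'\<close> stands for a projection of the tabulator \<open>T'\<close>, and \<open>e\<close> says that \<open>s\<close> lies over \<open>a\<close> once both
  are precomposed with the morphisms from \<open>I\<close>.\<close>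

lemma slice_hor_whisker:
  assumes \<chi>: "((T, t), (T', t'), s, \<chi>) \<in> dslice_hor D I" and p: "p' \<in> hhoms D T' A'"
    and f: "f \<in> hhoms D I A" and a: "a \<in> hhoms D A A'" and e: "hcomp D t (hcomp D s p') = hcomp D f a"
  shows "((A, f), (A', hcomp D t' p'), a, hcompsq D \<chi> (vidsq D p')) \<in> dslice_hor D I"
proof -
  have h: "t \<in> hhoms D I T" "t' \<in> hhoms D I T'" "s \<in> hhoms D T T'"
    "\<chi> \<in> squares D t' (hcomp D t s) (vid D I) (vid D T')" "vert_invertible D \<chi>"
    using \<chi> unfolding smor_iff by auto
  have "hcompsq D \<chi> (vidsq D p') \<in> squares D (hcomp D t' p') (hcomp D f a) (vid D I) (vid D A')"
    using hsq_in[OF h(4) vidsq_in[OF p]] cassoc[OF h(1,3) p] e by simp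
  then show ?thesis
    unfolding smor_iff using f a hcomp_in[OF h(2) p] inv_h[OF h(4,2) p h(5)] by simp
qed

text \<open>Both \<open>\<psi>\<close> and \<open>\<phi>\<close> are projections of one cell \<open>\<chi>\<close> at the tabulators, so the two sides of the
  equation are two ways of slicing the horizontal composite of \<open>\<chi>\<close> and \<open>\<tau>'\<close>.\<close>

lemma bi_initial_imp_square_compatible:
  assumes I: "I \<in> Obj D" and b: "bi_initial (hor_twocat D) I"
    and tab: "is_tabulator D u T \<tau>" and tab': "is_tabulator D u' T' \<tau>'"
    and m: "((A, f), (A', f'), a, \<psi>) \<in> dslice_hor D I" and n: "((B, g), (B', g'), b, \<phi>) \<in> dslice_hor D I"
    and u: "u \<in> vhoms D A B" and u': "u' \<in> vhoms D A' B'"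
    and \<gamma>: "\<gamma> \<in> squares D f g (vid D I) u" and \<gamma>': "\<gamma>' \<in> squares D f' g' (vid D I) u'"
    and \<alpha>: "\<alpha> \<in> squares D a b u u'"
  shows "vcompsq D \<psi> (hcompsq D \<gamma> \<alpha>) = vcompsq D \<gamma>' \<phi>"
proof -
  define p q p' q' where "p = sqtop D \<tau>" and "q = sqbot D \<tau>" and "p' = sqtop D \<tau>'" and "q' = sqbot D \<tau>'"
  note pq = p_def[symmetric] q_def[symmetric] p'_def[symmetric] q'_def[symmetric]
  have AB: "vdom D u = A" "vcod D u = B" "vdom D u' = A'" "vcod D u' = B'"
    using u u' by (simp_all add: vhoms_def)
  have h: "f \<in> hhoms D I A" "f' \<in> hhoms D I A'" "a \<in> hhoms D A A'"
    "g \<in> hhoms D I B" "g' \<in> hhoms D I B'" "b \<in> hhoms D B B'"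
    using m n unfolding smor_iff by auto
  have \<tau>: "p \<in> hhoms D T A" "q \<in> hhoms D T B" "\<tau> \<in> squares D p q (vid D T) u"
    using tab unfolding is_tabulator_def Let_def AB pq by auto
  have \<tau>': "p' \<in> hhoms D T' A'" "q' \<in> hhoms D T' B'" "\<tau>' \<in> squares D p' q' (vid D T') u'"
    using tab' unfolding is_tabulator_def Let_def AB pq by auto
  obtain t where t: "t \<in> hhoms D I T" "\<gamma> = hcompsq D (vidsq D t) \<tau>" "hcomp D t p = f" "hcomp D t q = g"
    using tabulator_factor[OF tab u h(1,4) \<gamma>] unfolding pq by blast
  obtain t' where t': "t' \<in> hhoms D I T'" "\<gamma>' = hcompsq D (vidsq D t') \<tau>'"
      "hcomp D t' p' = f'" "hcomp D t' q' = g'"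
    using tabulator_factor[OF tab' u' h(2,5) \<gamma>'] unfolding pq by blast
  \<comment> \<open>\<open>s\<close> is the action of \<open>\<alpha>\<close> on tabulators\<close>
  obtain s where s: "s \<in> hhoms D T T'" "hcompsq D \<tau> \<alpha> = hcompsq D (vidsq D s) \<tau>'"
      "hcomp D s p' = hcomp D p a" "hcomp D s q' = hcomp D q b"
    using tabulator_factor[OF tab' u' hcomp_in[OF \<tau>(1) h(3)] hcomp_in[OF \<tau>(2) h(6)] hsq_in[OF \<tau>(3) \<alpha>]]
    unfolding pq by blast
  obtain \<chi> where \<chi>: "((T, t), (T', t'), s, \<chi>) \<in> dslice_hor D I"
    using b[unfolded bi_initial_hor_twocat_iff[OF I]] t(1) t'(1) s(1) by blast
  have \<chi>_sq: "\<chi> \<in> squares D t' (hcomp D t s) (vid D I) (vid D T')"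
    using \<chi> unfolding smor_iff by auto
  have "hcomp D t (hcomp D s p') = hcomp D f a"
    using cassoc[OF t(1) \<tau>(1) h(3)] s(3) t(3) by simp
  from slice_hor_whisker[OF \<chi> \<tau>'(1) h(1,3) this]
  have \<psi>: "\<psi> = hcompsq D \<chi> (vidsq D p')"
    unfolding t'(3) by (rule bi_initial_comparison_unique[OF I b m])
  have "hcomp D t (hcomp D s q') = hcomp D g b"
    using cassoc[OF t(1) \<tau>(2) h(6)] s(4) t(4) by simp
  from slice_hor_whisker[OF \<chi> \<tau>'(2) h(4,6) this]
  have \<phi>: "\<phi> = hcompsq D \<chi> (vidsq D q')"
    unfolding t'(4) by (rule bi_initial_comparison_unique[OF I b n])
  note ts = hcomp_in[OF t(1) s(1)]
  have "hcompsq D \<gamma> \<alpha> = hcompsq D (vidsq D t) (hcompsq D (vidsq D s) \<tau>')"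
    unfolding t(2) s(2)[symmetric] by (rule hassoc[OF vidsq_in[OF t(1)] \<tau>(3) \<alpha>])
  also have "\<dots> = hcompsq D (vidsq D (hcomp D t s)) \<tau>'"
    unfolding idc[OF t(1) s(1)]
    by (rule hassoc[OF vidsq_in[OF t(1)] vidsq_in[OF s(1)] \<tau>'(3), symmetric])
  finally have "vcompsq D \<psi> (hcompsq D \<gamma> \<alpha>) =
      vcompsq D (hcompsq D \<chi> (vidsq D p')) (hcompsq D (vidsq D (hcomp D t s)) \<tau>')"
    by (simp add: \<psi>)
  also have "\<dots> = hcompsq D \<chi> \<tau>'"
    using inter[OF \<chi>_sq vidsq_in[OF \<tau>'(1)] vidsq_in[OF ts] \<tau>'(3)] vidr[OF \<chi>_sq] vidl[OF \<tau>'(3)] by simp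
  also have "\<dots> = vcompsq D (hcompsq D (vidsq D t') \<tau>') (hcompsq D \<chi> (vidsq D q'))"
    using inter[OF vidsq_in[OF t'(1)] \<tau>'(3) \<chi>_sq vidsq_in[OF \<tau>'(2)]] vidl[OF \<chi>_sq] vidr[OF \<tau>'(3)] by simp
  finally show ?thesis by (simp add: \<phi> t'(2))
qed

text \<open>A morphism from \<open>I\<close> to the tabulator of \<open>u\<close> restricts the square of the tabulator to one on \<open>I\<close>.\<close>

lemma bi_initial_imp_vertical_lift:
  assumes I: "I \<in> Obj D" and b: "bi_initial (hor_twocat D) I"
    and tab: "is_tabulator D u T \<tau>" and u: "u \<in> Ver D"
  shows "\<exists>\<gamma>. (u, \<gamma>) \<in> dslice_ver D I"
proof -
  have \<tau>: "T \<in> Obj D" "sqtop D \<tau> \<in> hhoms D T (vdom D u)" "sqbot D \<tau> \<in> hhoms D T (vcod D u)"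
    "\<tau> \<in> squares D (sqtop D \<tau>) (sqbot D \<tau>) (vid D T) u"
    using tab unfolding is_tabulator_def Let_def by auto
  obtain t where t: "t \<in> hhoms D I T"
    using b[unfolded bi_initial_hor_twocat_iff[OF I]] \<tau>(1) by blast
  have "u \<in> vhoms D (vdom D u) (vcod D u)" using u by (simp add: vhoms_def)
  from verI[OF hsq_in[OF vidsq_in[OF t] \<tau>(4)] hcomp_in[OF t \<tau>(2)] hcomp_in[OF t \<tau>(3)] this]
  show ?thesis ..
qed

lemma bi_initial_imp_double_bi_initial:
  assumes I: "I \<in> Obj D" and b: "bi_initial (hor_twocat D) I" and tabs: "has_tabulators D"
  shows "double_bi_initial D I"
proof -
  have tab: "\<exists>T \<tau>. is_tabulator D u T \<tau>" if "u \<in> Ver D" for u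
    using tabs that unfolding has_tabulators_def by blast
  have lift: "\<exists>\<gamma>. (u, \<gamma>) \<in> dslice_ver D I" if "u \<in> Ver D" for u
    using tab[OF that] bi_initial_imp_vertical_lift[OF I b _ that] by blast
  have compat: "vcompsq D \<psi> (hcompsq D \<gamma> \<alpha>) = vcompsq D \<gamma>' \<phi>"
    if h: "((A, f), (A', f'), a, \<psi>) \<in> dslice_hor D I" "((B, g), (B', g'), b, \<phi>) \<in> dslice_hor D I"
      "u \<in> vhoms D A B" "u' \<in> vhoms D A' B'" "\<gamma> \<in> squares D f g (vid D I) u"
      "\<gamma>' \<in> squares D f' g' (vid D I) u'" "\<alpha> \<in> squares D a b u u'"
    for A A' B B' f f' g g' a b \<psi> \<phi> u u' \<gamma> \<gamma>' \<alpha>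
  proof -
    have "u \<in> Ver D" "u' \<in> Ver D" using h(3,4) by (simp_all add: vhoms_def)
    then obtain T \<tau> T' \<tau>' where "is_tabulator D u T \<tau>" "is_tabulator D u' T' \<tau>'"
      using tab by blast
    from bi_initial_imp_square_compatible[OF I b this h] show ?thesis .
  qed
  note b' = b[unfolded bi_initial_hor_twocat_iff[OF I]]
  show ?thesis
    unfolding double_bi_initial_iff[OF I]
    by (intro conjI b'[THEN conjunct1] b'[THEN conjunct2, THEN conjunct1])
      (rule ballI, erule lift, intro allI impI ballI, rule compat)
qed

end

theorem theorem4:
  fixes D :: "('o, 'h, 'v, 's) dblcat" and I :: 'o
  assumes "double_category D"
    and "has_tabulators D"
    and "I \<in> Obj D"
  shows "double_bi_initial D I \<longleftrightarrow> bi_initial (hor_twocat D) I"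
proof -
  interpret double_category D by fact
  show ?thesis
    using double_bi_initial_imp_bi_initial bi_initial_imp_double_bi_initial assms(2,3) by blast
qed

end
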